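(* Let $\{X(t): t \in [0,\infty)\}$ be a centered stationary Gaussian process with almost surely continuous sample paths and covariance function $r(t) := \mathrm{Cov}(X(s), X(s+t))$ satisfying: (A1) $r(t) = 1 - C|t|^\alpha + o(|t|^\alpha)$ as $t \to 0$, for some $\alpha \in (0,2]$ and $C > 0$; (A2) $r(t) < 1$ for all $t > 0$; (A3) $r(t)\log(t) \to 0$ as $t \to \infty$. Let $T$ be a nonnegative random variable, independent of $\{X(t)\}$, such that $\mathbb{P}(T > t) = L(t)$ for some function $L$ slowly varying at $\infty$. Then, as $u \to \infty$, \[ \mathbb{P}\Big(\sup_{s \in [0,T]} X(s) > u\Big) = L\Big(u^{\frac{\alpha-2}{\alpha}} \exp(u^2/2)\Big)(1+o(1)). \] *)

theory Defs
  imports "HOL-Probability.Probability" "HOL-Library.Landau_Symbols"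
begin

definition centered_normal_law :: "'a measure \<Rightarrow> ('a \<Rightarrow> real) \<Rightarrow> bool" where
  "centered_normal_law M Y \<longleftrightarrow>
     (\<exists>\<sigma>::real. \<sigma> \<ge> 0 \<and>
        distr M borel Y = (if \<sigma> = 0 then return borel 0
                          else density lborel (normal_density 0 \<sigma>)))"

definition centered_gaussian_process ::
  "'a measure \<Rightarrow> real set \<Rightarrow> (real \<Rightarrow> 'a \<Rightarrow> real) \<Rightarrow> bool" where
  "centered_gaussian_process M I X \<longleftrightarrow>
     (\<forall>t\<in>I. X t \<in> borel_measurable M) \<and>
     (\<forall>F c. finite F \<and> F \<subseteq> I \<longrightarrow>
        centered_normal_law M (\<lambda>\<omega>. \<Sum>t\<in>F. c t * X t \<omega>))"

definition slowly_varying :: "(real \<Rightarrow> real) \<Rightarrow> bool" where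
  "slowly_varying L \<longleftrightarrow>
     (\<forall>\<^sub>F x in at_top. L x > 0) \<and>
     (\<forall>c>0. ((\<lambda>x. L (c * x) / L x) \<longlongrightarrow> 1) at_top)"

end

theory Submission
  imports Defs "HOL-Real_Asymp.Real_Asymp"
begin

text \<open>
  Let \<open>m = u\<^bsup>1 - 2/\<alpha>\<^esup> exp (u\<^sup>2 / 2)\<close>, the order of the time needed to see an exceedance of \<open>u\<close>. Slow
  variation makes the tail of \<open>T\<close> the same at \<open>\<epsilon> m\<close>, \<open>m\<close> and \<open>A m\<close>, so Pickands' constant plays no
  role and crude bounds on the supremum suffice. From below, a second moment argument on the grid of
  mesh \<open>u\<^bsup>-2/\<alpha>\<^esup>\<close> shows that an exceedance occurs in \<open>[0, A m]\<close> with probability at least \<open>1 - O(1/A)\<close>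
  in the limit. From above, chaining gives probability \<open>O(1/m)\<close> for an exceedance in a unit interval,
  so those before \<open>\<epsilon> m\<close> contribute at most \<open>O(1/m)\<close> times the sum of the tail of \<open>T\<close> up to \<open>\<epsilon> m\<close>,
  which is \<open>O(\<epsilon>)\<close> times the tail at \<open>m\<close>.
\<close>

subsection \<open>The standard normal tail\<close>

text \<open>A unit of time holds about \<open>u powr (2 / \<alpha>)\<close> grid points, each
  exceeding u with probability of order \<open>exp (- u^2 / 2) / u\<close>, so 1 / m is the order of
  the expected number of grid exceedances per unit time. The obstacle is dependence. (A3) gives no
  rate beyond r(t) ln t -> 0, but at lags above \<open>exp (\<beta> * u^2)\<close> it makes u^2 |r|
  small, which is what keeps a joint exceedance asymptotically no likelier than
  \<open>(gauss_tail u)^2\<close>. For small \<beta> the shorter lags are few enough to be paid for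
  by a uniform gap between r and 1. The far pairs must come with leading constant 1, since otherwise
  the second moment could not give a probability close to 1; near pairs and chaining may lose any
  constant factor, which is absorbed in A or \<epsilon>. The additive O(1/m) is negligible because y
  L(y) tends to infinity. The supremum over an uncountable set of times need not be an event, so the
  estimates concern countably many times, and the completion enters only when the two are
  compared.\<close>

definition gauss_tail :: "real \<Rightarrow> real" where
  "gauss_tail v = measure std_normal_distribution {v<..}"

interpretation std_normal: real_distribution std_normal_distribution
  by (rule real_dist_normal_dist)

lemma gauss_tail_nonneg: "0 \<le> gauss_tail v"
  by (simp add: gauss_tail_def)

lemma gauss_tail_le_1: "gauss_tail v \<le> 1"
  by (simp add: gauss_tail_def)

lemma gauss_tail_mono: "v \<le> w \<Longrightarrow> gauss_tail w \<le> gauss_tail v"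
  unfolding gauss_tail_def by (intro std_normal.finite_measure_mono) auto

lemma ennreal_gauss_tail: "ennreal (gauss_tail v) = emeasure std_normal_distribution {v<..}"
  by (simp add: gauss_tail_def std_normal.emeasure_eq_measure)

text \<open>The closed half line, which differs from the open one by a null set, is the form needed
  for the fundamental theorem of calculus on \<open>{v..}\<close>.\<close>

lemma gauss_tail_nn_integral:
  "ennreal (gauss_tail v) = (\<integral>\<^sup>+x. ennreal (std_normal_density x) * indicator {v..} x \<partial>lborel)"
  unfolding ennreal_gauss_tail
  by (subst emeasure_density) (auto intro!: nn_integral_cong_AE AE_I[where N="{v}"] split: split_indicator_asm)

lemma measure_centered_normal_tail:
  assumes "\<sigma> > 0"
  shows "measure (density lborel (normal_density 0 \<sigma>)) {v<..} = gauss_tail (v / \<sigma>)"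
proof -
  have "emeasure (density lborel (normal_density 0 \<sigma>)) {v<..} =
     (\<integral>\<^sup>+x. ennreal (normal_density 0 \<sigma> x) * indicator {v<..} x \<partial>lborel)"
    by (subst emeasure_density) auto
  also have "\<dots> = ennreal \<sigma> * (\<integral>\<^sup>+x. ennreal (normal_density 0 \<sigma> (\<sigma> * x)) * indicator {v<..} (\<sigma> * x) \<partial>lborel)"
    using assms by (subst nn_integral_real_affine[where c=\<sigma> and t=0]) auto
  also have "\<dots> = (\<integral>\<^sup>+x. ennreal \<sigma> * (ennreal (normal_density 0 \<sigma> (\<sigma> * x)) * indicator {v<..} (\<sigma> * x)) \<partial>lborel)"
    by (subst nn_integral_cmult) auto
  also have "\<dots> = (\<integral>\<^sup>+x. ennreal (std_normal_density x) * indicator {v/\<sigma><..} x \<partial>lborel)"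
  proof (rule nn_integral_cong)
    fix x :: real
    have "\<sigma> * normal_density 0 \<sigma> (\<sigma> * x) = std_normal_density x"
      using assms by (simp add: normal_density_def real_sqrt_mult field_simps)
    moreover have "indicator {v<..} (\<sigma> * x) = (indicator {v/\<sigma><..} x :: ennreal)"
      using assms by (auto simp: field_simps split: split_indicator)
    ultimately show "ennreal \<sigma> * (ennreal (normal_density 0 \<sigma> (\<sigma> * x)) * indicator {v<..} (\<sigma> * x)) =
       ennreal (std_normal_density x) * indicator {v/\<sigma><..} x"
      using assms by (simp add: mult.assoc[symmetric] ennreal_mult[symmetric])
  qed
  also have "\<dots> = emeasure std_normal_distribution {v/\<sigma><..}"
    by (subst emeasure_density) auto
  finally show ?thesis by (simp add: gauss_tail_def measure_def)
qed

section \<open>Bounds for the Mills ratio and their behaviour under scaling of the threshold\<close>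

lemma std_normal_density_deriv:
  "(std_normal_density has_real_derivative - x * std_normal_density x) (at x)"
  unfolding std_normal_density_def[abs_def]
  by (auto intro!: derivative_eq_intros simp: field_simps)

lemma std_normal_density_tendsto_0: "(std_normal_density \<longlongrightarrow> 0) at_top"
  unfolding std_normal_density_def[abs_def] by real_asymp

text \<open>On the domain of integration \<open>x / v >= 1\<close>, and inserting this factor
  produces the integrand x times the density, which has an elementary antiderivative.\<close>

lemma gauss_tail_upper:
  assumes "v > 0"
  shows "gauss_tail v \<le> std_normal_density v / v"
proof -
  have "ennreal (gauss_tail v) \<le> (\<integral>\<^sup>+x. ennreal (x / v * std_normal_density x) * indicator {v..} x \<partial>lborel)"
    unfolding gauss_tail_nn_integral
  proof (intro nn_integral_mono, goal_cases)
    case (1 x)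
    show ?case
    proof (cases "v \<le> x")
      case True
      then have "1 * std_normal_density x \<le> x / v * std_normal_density x"
        using assms by (intro mult_right_mono) auto
      then show ?thesis using True by (auto intro!: ennreal_leI)
    qed auto
  qed
  also have "\<dots> = ennreal (0 - (- std_normal_density v / v))"
  proof (rule nn_integral_FTC_atLeast[where F="\<lambda>x. - std_normal_density x / v"])
    show "((\<lambda>x. - std_normal_density x / v) \<longlongrightarrow> 0) at_top"
      using tendsto_divide[OF tendsto_minus[OF std_normal_density_tendsto_0] tendsto_const[of v]] assms by simp
  qed (use assms in \<open>auto intro!: derivative_eq_intros std_normal_density_deriv simp: field_simps\<close>)
  finally show ?thesis using assms by (simp add: ennreal_le_iff)
qed

text \<open>The integrand \<open>f\<close> is the derivative of \<open>- x / (1 + x^2)\<close> times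
  the density. Its rational factor has numerator \<open>(1 + x^2)^2 - 2\<close>, hence is below 1;
  \<open>v >= 1\<close> keeps it nonnegative.\<close>

lemma gauss_tail_lower:
  assumes "v \<ge> 1"
  shows "gauss_tail v \<ge> std_normal_density v / v * (v\<^sup>2 / (1 + v\<^sup>2))"
proof -
  define f :: "real \<Rightarrow> real" where "f x = (x^4 + 2 * x\<^sup>2 - 1) / (1 + x\<^sup>2)\<^sup>2 * std_normal_density x" for x
  have pos: "1 + x\<^sup>2 > 0" for x :: real by (simp add: add_pos_nonneg)
  have "ennreal (0 - (- (v / (1 + v\<^sup>2) * std_normal_density v))) = (\<integral>\<^sup>+x. ennreal (f x) * indicator {v..} x \<partial>lborel)"
  proof (rule nn_integral_FTC_atLeast[where F="\<lambda>x. - (x / (1 + x\<^sup>2) * std_normal_density x)", symmetric])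
    show "f \<in> borel_measurable borel" unfolding f_def by measurable
    show "((\<lambda>x. - (x / (1 + x\<^sup>2) * std_normal_density x)) \<longlongrightarrow> 0) at_top"
      unfolding std_normal_density_def by real_asymp
    fix x :: real assume x: "v \<le> x"
    then have "1 ^ 4 \<le> x ^ 4" using assms by (intro power_mono) auto
    then have "1 \<le> x ^ 4" by simp
    moreover have "0 \<le> 2 * x^2" by simp
    ultimately have "0 \<le> x ^ 4 + 2 * x^2 - 1" by linarith
    then show "0 \<le> f x" unfolding f_def by (intro mult_nonneg_nonneg divide_nonneg_nonneg) auto
    have "1 + x\<^sup>2 \<noteq> 0" using pos[of x] by simp
    then show "((\<lambda>x. - (x / (1 + x\<^sup>2) * std_normal_density x)) has_real_derivative f x) (at x)"
      unfolding f_def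
      by (auto intro!: derivative_eq_intros std_normal_density_deriv)
         (simp add: divide_simps power2_eq_square, simp add: algebra_simps power4_eq_xxxx)
  qed
  also have "\<dots> \<le> ennreal (gauss_tail v)"
    unfolding gauss_tail_nn_integral
  proof (intro nn_integral_mono, goal_cases)
    case (1 x)
    have "x ^ 4 + 2 * x\<^sup>2 - 1 \<le> (1 + x\<^sup>2)\<^sup>2" by (simp add: power2_eq_square power4_eq_xxxx algebra_simps)
    then have "f x \<le> 1 * std_normal_density x" unfolding f_def
      by (intro mult_right_mono) (auto simp: divide_le_eq)
    then show ?case by (auto intro!: ennreal_leI split: split_indicator)
  qed
  finally have "v / (1 + v\<^sup>2) * std_normal_density v \<le> gauss_tail v"
    by (simp add: ennreal_le_iff gauss_tail_nonneg)
  moreover have "std_normal_density v / v * (v\<^sup>2 / (1 + v\<^sup>2)) = v / (1 + v\<^sup>2) * std_normal_density v"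
    using assms by (simp add: power2_eq_square)
  ultimately show ?thesis by simp
qed

lemma gauss_tail_pos: "gauss_tail v > 0"
proof -
  define w where "w = max v 1"
  have "0 < std_normal_density w / w * (w\<^sup>2 / (1 + w\<^sup>2))"
    by (auto simp: w_def intro!: mult_pos_pos divide_pos_pos add_pos_nonneg normal_density_pos)
  also have "\<dots> \<le> gauss_tail w" by (rule gauss_tail_lower) (simp add: w_def)
  also have "\<dots> \<le> gauss_tail v" by (rule gauss_tail_mono) (simp add: w_def)
  finally show ?thesis .
qed

lemma std_normal_density_scale:
  "std_normal_density (u * sqrt (1 + x)) = std_normal_density u * exp (- u\<^sup>2 * x / 2)" if "x \<ge> -1"
  using that by (simp add: std_normal_density_def power_mult_distrib exp_add[symmetric]) (simp add: field_simps)

lemma density_le_gauss_tail: "u \<ge> 1 \<Longrightarrow> std_normal_density u / u \<le> 2 * gauss_tail u"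
proof -
  assume u: "u \<ge> 1"
  then have "1 \<le> u\<^sup>2" by (simp add: one_le_power)
  then have "1 / 2 \<le> u\<^sup>2 / (1 + u\<^sup>2)" by (simp add: pos_le_divide_eq add_pos_nonneg)
  then have "std_normal_density u / u * (1/2) \<le> std_normal_density u / u * (u\<^sup>2 / (1 + u\<^sup>2))"
    using u by (intro mult_left_mono) auto
  also have "\<dots> \<le> gauss_tail u" using u by (rule gauss_tail_lower)
  finally show ?thesis by simp
qed

text \<open>Used for pairs at small lags, where a constant factor such as 2 is harmless.\<close>

lemma gauss_tail_scale_up:
  assumes "u \<ge> 1" "x \<ge> 0"
  shows "gauss_tail (u * sqrt (1 + x)) \<le> 2 * gauss_tail u * exp (- u\<^sup>2 * x / 2)"
proof -
  have u: "1 \<le> sqrt (1 + x)" "0 < u" using assms by auto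
  have "gauss_tail (u * sqrt (1 + x)) \<le> std_normal_density (u * sqrt (1 + x)) / (u * sqrt (1 + x))"
    using assms by (intro gauss_tail_upper) auto
  also have "\<dots> \<le> std_normal_density (u * sqrt (1 + x)) / (u * 1)"
    using u by (intro divide_left_mono mult_left_mono) auto
  also have "\<dots> = std_normal_density u / u * exp (- u\<^sup>2 * x / 2)"
    using assms by (subst std_normal_density_scale) auto
  also have "\<dots> \<le> (2 * gauss_tail u) * exp (- u\<^sup>2 * x / 2)"
    using assms by (intro mult_right_mono density_le_gauss_tail) auto
  finally show ?thesis .
qed

text \<open>Used for pairs at large lags, so no constant may be lost: for x of order
  \<open>1 / u^2\<close> the factors before the exponential tend to 1. This is why the lower Mills
  bound is kept in its sharp form.\<close>

lemma gauss_tail_scale_down: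
  assumes "u \<ge> 1" "0 \<le> x"
  shows "gauss_tail (u / sqrt (1 + x)) \<le>
    gauss_tail u * ((1 + 1 / u\<^sup>2) * sqrt (1 + x) * exp (u\<^sup>2 * x / 2))"
proof -
  have sx: "sqrt (1 + x) > 0" "u > 0" using assms by auto
  have eq: "u / sqrt (1 + x) = u * sqrt (1 + - x / (1 + x))"
  proof -
    have "1 + - x / (1 + x) = 1 / (1 + x)" using assms by (simp add: field_simps)
    then show ?thesis by (simp add: real_sqrt_divide)
  qed
  have "gauss_tail (u / sqrt (1 + x)) \<le> std_normal_density (u / sqrt (1 + x)) / (u / sqrt (1 + x))"
    using sx by (intro gauss_tail_upper) auto
  also have "\<dots> = std_normal_density u / u * exp (u\<^sup>2 * (x / (1 + x)) / 2) * sqrt (1 + x)"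
  proof -
    have "std_normal_density (u / sqrt (1 + x)) = std_normal_density u * exp (u\<^sup>2 * (x / (1 + x)) / 2)"
      unfolding eq using assms by (subst std_normal_density_scale) (auto simp: field_simps)
    then show ?thesis by simp
  qed
  also have "\<dots> \<le> std_normal_density u / u * exp (u\<^sup>2 * x / 2) * sqrt (1 + x)"
    using assms by (intro mult_right_mono mult_left_mono) (auto simp: divide_simps intro!: mult_left_mono)
  also have "std_normal_density u / u \<le> gauss_tail u * (1 + 1 / u\<^sup>2)"
  proof -
    have "std_normal_density u / u * (u\<^sup>2 / (1 + u\<^sup>2)) * (1 + 1 / u\<^sup>2) \<le> gauss_tail u * (1 + 1 / u\<^sup>2)"
      using assms by (intro mult_right_mono gauss_tail_lower) auto
    moreover have "u\<^sup>2 / (1 + u\<^sup>2) * (1 + 1 / u\<^sup>2) = 1"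
      using sx by (simp add: divide_simps add_nonneg_eq_0_iff)
    ultimately show ?thesis by (metis mult.assoc mult.right_neutral)
  qed
  finally show ?thesis using assms by (simp add: mult_ac)
qed

subsection \<open>Independence and Gaussian laws\<close>

text \<open>Normalise the weight to a probability density. By \<open>char\<close>, the variable Y
  has the same characteristic function under the reweighted measure \<open>N\<close> as under
  \<open>M\<close>, hence the same law.\<close>

lemma (in prob_space) integral_weight_indicator_eq:
  fixes w Y :: "'a \<Rightarrow> real"
  assumes [measurable]: "w \<in> borel_measurable M" "Y \<in> borel_measurable M" "B \<in> sets borel"
    and w: "\<And>x. 0 \<le> w x" "integrable M w" "(\<integral>x. w x \<partial>M) > 0"
    and char: "\<And>b. (\<integral>x. w x *\<^sub>R iexp (b * Y x) \<partial>M) = (\<integral>x. w x \<partial>M) *\<^sub>R (\<integral>x. iexp (b * Y x) \<partial>M)"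
  shows "(\<integral>x. w x * indicator B (Y x) \<partial>M) = (\<integral>x. w x \<partial>M) * prob (Y -` B \<inter> space M)"
proof -
  define c where "c = (\<integral>x. w x \<partial>M)"
  define N where "N = density M (\<lambda>x. ennreal (w x / c))"
  have c: "c > 0" using w c_def by simp
  have [measurable_cong]: "sets N = sets M" by (simp add: N_def)
  have N: "prob_space N"
  proof
    have "emeasure N (space N) = (\<integral>\<^sup>+x. ennreal (w x / c) * indicator (space M) x \<partial>M)"
      by (simp add: N_def emeasure_density)
    also have "\<dots> = (\<integral>\<^sup>+x. ennreal (w x / c) \<partial>M)"
      by (intro nn_integral_cong) auto
    also have "\<dots> = ennreal (\<integral>x. w x / c \<partial>M)"
      using w c by (intro nn_integral_eq_integral) auto
    also have "\<dots> = 1" using c by (simp add: c_def)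
    finally show "emeasure N (space N) = 1" .
  qed
  then interpret N: prob_space N .
  have [measurable]: "Y \<in> borel_measurable N" by measurable
  have 1: "real_distribution (distr N borel Y)" "real_distribution (distr M borel Y)"
    by (auto intro!: real_distribution.intro real_distribution_axioms.intro N.prob_space_distr prob_space_distr)
  have "char (distr N borel Y) = char (distr M borel Y)"
  proof
    fix b
    have "char (distr N borel Y) b = (\<integral>x. iexp (b * Y x) \<partial>N)"
      by (simp add: char_def integral_distr)
    also have "\<dots> = (\<integral>x. (w x / c) *\<^sub>R iexp (b * Y x) \<partial>M)"
      unfolding N_def using w c by (subst integral_density) auto
    also have "\<dots> = (\<integral>x. (1 / c) *\<^sub>R (w x *\<^sub>R iexp (b * Y x)) \<partial>M)"
      by (simp add: divide_inverse mult.commute)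
    also have "\<dots> = (1 / c) *\<^sub>R (\<integral>x. w x *\<^sub>R iexp (b * Y x) \<partial>M)"
      by (rule integral_scaleR_right) 
    also have "\<dots> = (\<integral>x. iexp (b * Y x) \<partial>M)"
      unfolding char c_def[symmetric] using c by simp
    also have "\<dots> = char (distr M borel Y) b"
      by (simp add: char_def integral_distr)
    finally show "char (distr N borel Y) b = char (distr M borel Y) b" .
  qed
  then have eq: "distr N borel Y = distr M borel Y"
    using 1 by (intro Levy_uniqueness)
  have "prob (Y -` B \<inter> space M) = measure (distr M borel Y) B"
    by (simp add: measure_distr)
  also have "\<dots> = measure N (Y -` B \<inter> space N)"
    unfolding eq[symmetric] by (simp add: measure_distr)
  also have "\<dots> = (\<integral>x. indicator (Y -` B \<inter> space N) x \<partial>N)"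
    by simp
  also have "\<dots> = (\<integral>x. indicator B (Y x) \<partial>N)"
    by (intro Bochner_Integration.integral_cong refl) (auto split: split_indicator)
  also have "\<dots> = (\<integral>x. (w x / c) *\<^sub>R indicator B (Y x) \<partial>M)"
    unfolding N_def using w c by (subst integral_density) auto
  also have "\<dots> = (\<integral>x. w x * indicator B (Y x) \<partial>M) / c"
    by simp
  finally show ?thesis using c by (simp add: c_def[symmetric] field_simps)
qed

lemma (in prob_space) integrable_bounded_borel:
  fixes f :: "'a \<Rightarrow> 'b::{banach, second_countable_topology}"
  assumes "f \<in> borel_measurable M" "\<And>x. norm (f x) \<le> B"
  shows "integrable M f"
  using assms by (intro integrable_const_bound[where B=B]) auto

lemma (in prob_space) integral_indicator_comp:
  assumes [measurable]: "Y \<in> borel_measurable M" "B \<in> sets borel"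
  shows "(\<integral>x. indicator B (Y x) \<partial>M) = prob (Y -` B \<inter> space M)"
proof -
  have "(\<integral>x. indicator B (Y x) \<partial>M) = (\<integral>x. indicator (Y -` B \<inter> space M) x \<partial>M :: real)"
    by (intro Bochner_Integration.integral_cong refl) (auto split: split_indicator)
  then show ?thesis by simp
qed

text \<open>One-dimensional uniqueness of characteristic functions is applied twice: to the law of
  \<open>Y\<close> reweighted by \<open>2 + cos (a X)\<close> and \<open>2 + sin (a X)\<close>, and then to the law of \<open>X\<close> given \<open>Y \<in> B\<close>.\<close>
lemma (in prob_space) indep_var_if_char_factorizes:
  fixes X Y :: "'a \<Rightarrow> real"
  assumes [measurable]: "X \<in> borel_measurable M" "Y \<in> borel_measurable M"
    and fact: "\<And>a b. (\<integral>x. iexp (a * X x + b * Y x) \<partial>M) = (\<integral>x. iexp (a * X x) \<partial>M) * (\<integral>x. iexp (b * Y x) \<partial>M)"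
  shows "indep_var borel X borel Y"
proof -
  have int: "integrable M (\<lambda>x. iexp (f x))" if [measurable]: "f \<in> borel_measurable M" for f
    by (rule integrable_bounded_borel[where B=1]) auto
  have intc: "integrable M (\<lambda>x. cos (f x))" "integrable M (\<lambda>x. sin (f x))"
    if [measurable]: "f \<in> borel_measurable M" for f :: "'a \<Rightarrow> real"
    by (auto intro!: integrable_bounded_borel[where B=1])
  have ii: "integrable M (\<lambda>x. iexp (a * X x + b * Y x))" "integrable M (\<lambda>x. iexp (a * X x))" "integrable M (\<lambda>x. iexp (b * Y x))" for a b
    by (intro int; measurable)+
  have weight: "(\<integral>x. f (a * X x) * indicator B (Y x) \<partial>M) = (\<integral>x. f (a * X x) \<partial>M) * prob (Y -` B \<inter> space M)"
    if B[measurable]: "B \<in> sets borel" and f[measurable]: "f \<in> borel_measurable borel" and bd: "\<And>x::real. \<bar>f x\<bar> \<le> (1::real)"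
     and ex: "\<exists>p q. \<forall>x. complex_of_real (f x) = p * iexp x + q * iexp (- x)" for f a B
  proof -
    from ex obtain p q where fe: "complex_of_real (f x) = p * iexp x + q * iexp (- x)" for x
      by blast
    have intf: "integrable M (\<lambda>x. f (a * X x))"
      by (rule integrable_bounded_borel[where B=1]) (auto simp: bd)
    have fc: "(\<integral>x. f (a * X x) *\<^sub>R iexp (b * Y x) \<partial>M) = (\<integral>x. f (a * X x) \<partial>M) *\<^sub>R (\<integral>x. iexp (b * Y x) \<partial>M)" for b
    proof -
      have "(\<integral>x. f (a * X x) *\<^sub>R iexp (b * Y x) \<partial>M) =
        (\<integral>x. p * iexp (a * X x + b * Y x) + q * iexp (- a * X x + b * Y x) \<partial>M)"
        by (intro Bochner_Integration.integral_cong refl)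
           (simp add: scaleR_conv_of_real fe algebra_simps exp_add exp_minus exp_diff divide_inverse)
      also have "\<dots> = p * (\<integral>x. iexp (a * X x + b * Y x) \<partial>M) + q * (\<integral>x. iexp (- a * X x + b * Y x) \<partial>M)"
        by (subst Bochner_Integration.integral_add) (simp_all only: ii integrable_mult_right integral_mult_right_zero)
      also have "\<dots> = (p * (\<integral>x. iexp (a * X x) \<partial>M) + q * (\<integral>x. iexp (- a * X x) \<partial>M)) * (\<integral>x. iexp (b * Y x) \<partial>M)"
        unfolding fact by (simp add: algebra_simps)
      also have "p * (\<integral>x. iexp (a * X x) \<partial>M) + q * (\<integral>x. iexp (- a * X x) \<partial>M) =
         (\<integral>x. p * iexp (a * X x) + q * iexp (- a * X x) \<partial>M)"
        by (subst Bochner_Integration.integral_add) (simp_all only: ii integrable_mult_right integral_mult_right_zero)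
      also have "\<dots> = (\<integral>x. complex_of_real (f (a * X x)) \<partial>M)"
        by (intro Bochner_Integration.integral_cong refl) (simp add: fe)
      also have "\<dots> = complex_of_real (\<integral>x. f (a * X x) \<partial>M)"
        by (rule integral_complex_of_real)
      finally show ?thesis by (simp add: scaleR_conv_of_real)
    qed
    \<comment> \<open>Adding 2 turns the bounded function into a weight that is at least 1 and so
      has positive mean. The constant part is removed again by linearity.\<close>
    have nonneg: "0 \<le> 2 + f x" for x using bd[of x] by linarith
    have fi: "(\<integral>x. 2 + f (a * X x) \<partial>M) = 2 + (\<integral>x. f (a * X x) \<partial>M)"
      using intf by (subst Bochner_Integration.integral_add) (auto simp: prob_space)
    have le: "\<bar>\<integral>x. f (a * X x) \<partial>M\<bar> \<le> 1"
    proof -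
      have "norm (\<integral>x. f (a * X x) \<partial>M) \<le> (\<integral>x. norm (f (a * X x)) \<partial>M)"
        by (rule integral_norm_bound)
      also have "\<dots> \<le> (\<integral>x. 1 \<partial>M)"
        using intf bd by (intro integral_mono) auto
      finally show ?thesis by (simp add: prob_space)
    qed
    have fy: "integrable M (\<lambda>x. f (a * X x) *\<^sub>R iexp (b * Y x))" for b
      by (rule integrable_bounded_borel[where B=1]) (auto simp: bd norm_mult)
    have "(\<integral>x. (2 + f (a * X x)) * indicator B (Y x) \<partial>M) = (\<integral>x. 2 + f (a * X x) \<partial>M) * prob (Y -` B \<inter> space M)"
    proof (rule integral_weight_indicator_eq)
      show "(\<integral>x. (2 + f (a * X x)) *\<^sub>R iexp (b * Y x) \<partial>M) =
         (\<integral>x. 2 + f (a * X x) \<partial>M) *\<^sub>R (\<integral>x. iexp (b * Y x) \<partial>M)" for b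
      proof -
        have "(\<integral>x. (2 + f (a * X x)) *\<^sub>R iexp (b * Y x) \<partial>M) =
           (\<integral>x. 2 *\<^sub>R iexp (b * Y x) + f (a * X x) *\<^sub>R iexp (b * Y x) \<partial>M)"
          by (simp add: scaleR_left_distrib)
        also have "\<dots> = 2 *\<^sub>R (\<integral>x. iexp (b * Y x) \<partial>M) + (\<integral>x. f (a * X x) *\<^sub>R iexp (b * Y x) \<partial>M)"
          by (subst Bochner_Integration.integral_add) (simp_all only: ii fy integrable_scaleR_right integral_scaleR_right)
        finally show ?thesis unfolding fi fc by (simp add: scaleR_left_distrib)
      qed
    qed (use nonneg fi le intf in auto)
    moreover have "(\<integral>x. (2 + f (a * X x)) * indicator B (Y x) \<partial>M) =
       2 * prob (Y -` B \<inter> space M) + (\<integral>x. f (a * X x) * indicator B (Y x) \<partial>M)"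
    proof -
      have i1: "integrable M (\<lambda>x. 2 * indicator B (Y x) :: real)" "integrable M (\<lambda>x. f (a * X x) * indicator B (Y x))"
        by (auto intro!: integrable_bounded_borel[where B=2] simp: bd order_trans[OF bd] split: split_indicator)
      then show ?thesis by (simp add: distrib_right integral_indicator_comp)
    qed
    ultimately show ?thesis unfolding fi by (simp add: algebra_simps)
  qed
  have part2: "(\<integral>x. indicator B (Y x) *\<^sub>R iexp (a * X x) \<partial>M) = prob (Y -` B \<inter> space M) *\<^sub>R (\<integral>x. iexp (a * X x) \<partial>M)"
    if B[measurable]: "B \<in> sets borel" for a B
  proof -
    have ie: "iexp t = complex_of_real (cos t) + \<i> * complex_of_real (sin t)" for t
      by (simp add: exp_Euler cos_of_real sin_of_real)
    have ie': "exp (- (\<i> * complex_of_real t)) = complex_of_real (cos t) - \<i> * complex_of_real (sin t)" for t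
      using ie[of "- t"] by simp
    have c: "(\<integral>x. cos (a * X x) * indicator B (Y x) \<partial>M) = (\<integral>x. cos (a * X x) \<partial>M) * prob (Y -` B \<inter> space M)"
      by (rule weight) (auto simp: ie ie' add_divide_distrib diff_divide_distrib intro!: exI[of _ "1/2"])
    have s: "(\<integral>x. sin (a * X x) * indicator B (Y x) \<partial>M) = (\<integral>x. sin (a * X x) \<partial>M) * prob (Y -` B \<inter> space M)"
    proof (rule weight)
      show "\<exists>p q. \<forall>x. complex_of_real (sin x) = p * iexp x + q * iexp (- x)"
        by (rule exI[of _ "- \<i> / 2"], rule exI[of _ "\<i> / 2"])
           (auto simp: ie ie' algebra_simps add_divide_distrib diff_divide_distrib)
    qed auto
    have i1: "integrable M (\<lambda>x. cos (a * X x) * indicator B (Y x))" "integrable M (\<lambda>x. sin (a * X x) * indicator B (Y x))"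
      by (auto intro!: integrable_bounded_borel[where B=1] split: split_indicator)
    have i0: "integrable M (\<lambda>x. cos (a * X x))" "integrable M (\<lambda>x. sin (a * X x))"
      by (auto intro!: intc)
    have "(\<integral>x. indicator B (Y x) *\<^sub>R iexp (a * X x) \<partial>M) =
      (\<integral>x. complex_of_real (cos (a * X x) * indicator B (Y x)) + \<i> * complex_of_real (sin (a * X x) * indicator B (Y x)) \<partial>M)"
      by (intro Bochner_Integration.integral_cong refl) (simp only: ie, auto split: split_indicator)
    also have "\<dots> = complex_of_real (\<integral>x. cos (a * X x) * indicator B (Y x) \<partial>M) + \<i> * complex_of_real (\<integral>x. sin (a * X x) * indicator B (Y x) \<partial>M)"
      using i1 by (subst Bochner_Integration.integral_add)
        (auto simp only: integral_mult_right_zero integral_complex_of_real intro!: integrable_mult_right integrable_of_real)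
    also have "\<dots> = (complex_of_real (\<integral>x. cos (a * X x) \<partial>M) + \<i> * complex_of_real (\<integral>x. sin (a * X x) \<partial>M)) * of_real (prob (Y -` B \<inter> space M))"
      unfolding c s by (simp add: algebra_simps)
    also have "complex_of_real (\<integral>x. cos (a * X x) \<partial>M) + \<i> * complex_of_real (\<integral>x. sin (a * X x) \<partial>M) = (\<integral>x. iexp (a * X x) \<partial>M)"
      unfolding ie using i0 by (subst Bochner_Integration.integral_add)
        (auto simp only: integral_mult_right_zero integral_complex_of_real intro!: integrable_mult_right integrable_of_real)
    finally show ?thesis by (simp add: scaleR_conv_of_real)
  qed
  have main: "prob ((X -` A \<inter> space M) \<inter> (Y -` B \<inter> space M)) = prob (X -` A \<inter> space M) * prob (Y -` B \<inter> space M)"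
    if AB[measurable]: "A \<in> sets borel" "B \<in> sets borel" for A B
  \<comment> \<open>An indicator weight can be normalised only if its mean is positive; otherwise
    both sides vanish.\<close>
  proof (cases "prob (Y -` B \<inter> space M) = 0")
    case True
    have "prob ((X -` A \<inter> space M) \<inter> (Y -` B \<inter> space M)) \<le> prob (Y -` B \<inter> space M)"
      by (intro finite_measure_mono) auto
    with True show ?thesis by (simp add: measure_le_0_iff)
  next
    case False
    have i: "(\<integral>x. indicator B (Y x) \<partial>M) = prob (Y -` B \<inter> space M)"
      by (simp add: integral_indicator_comp)
    have "(\<integral>x. indicator B (Y x) * indicator A (X x) \<partial>M) = (\<integral>x. indicator B (Y x) \<partial>M) * prob (X -` A \<inter> space M)"
    proof (rule integral_weight_indicator_eq)
      show "integrable M (\<lambda>x. indicator B (Y x) :: real)"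
        by (rule integrable_bounded_borel[where B=1]) (auto split: split_indicator)
      show "(\<integral>x. indicator B (Y x) \<partial>M) > (0::real)"
        unfolding i using False by (simp add: zero_less_measure_iff)
      show "(\<integral>x. indicator B (Y x) *\<^sub>R iexp (b * X x) \<partial>M) =
         (\<integral>x. indicator B (Y x) \<partial>M) *\<^sub>R (\<integral>x. iexp (b * X x) \<partial>M)" for b
        unfolding i by (rule part2) simp
    qed auto
    moreover have "(\<integral>x. indicator B (Y x) * indicator A (X x) \<partial>M) = (\<integral>x. indicator ((X -` A \<inter> space M) \<inter> (Y -` B \<inter> space M)) x \<partial>M :: real)"
      by (intro Bochner_Integration.integral_cong refl) (auto split: split_indicator)
    ultimately show ?thesis by (simp add: i mult.commute)
  qed
  show ?thesis
    unfolding indep_var_eq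
    by (intro conjI indep_set_sigma_sets indep_setI Int_stableI)
       (auto simp: main, (metis sets.Int vimage_Int Int_assoc Int_left_commute inf.idem)+)
qed

text \<open>The standard deviation is only known to exist. Identifying its square with the second
  moment makes the law computable from the covariance function.\<close>

lemma (in prob_space) centered_normal_law_second_moment:
  assumes Y[measurable]: "Y \<in> borel_measurable M" and law: "centered_normal_law M Y"
  shows "integrable M (\<lambda>x. (Y x)\<^sup>2)"
    and "distr M borel Y = (if (\<integral>x. (Y x)\<^sup>2 \<partial>M) = 0 then return borel 0
          else density lborel (normal_density 0 (sqrt (\<integral>x. (Y x)\<^sup>2 \<partial>M))))"
proof -
  from law obtain \<sigma> where \<sigma>: "\<sigma> \<ge> 0"
    and d: "distr M borel Y = (if \<sigma> = 0 then return borel 0 else density lborel (normal_density 0 \<sigma>))"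
    unfolding centered_normal_law_def by auto
  have "integrable (distr M borel Y) (\<lambda>y. y\<^sup>2) \<and> (\<integral>y. y\<^sup>2 \<partial>distr M borel Y) = \<sigma>\<^sup>2"
  proof (cases "\<sigma> = 0")
    case True
    have "AE y in return borel (0::real). y\<^sup>2 = 0" by (simp add: AE_return)
    then have "integrable (return borel (0::real)) (\<lambda>y. y\<^sup>2)"
      by (subst integrable_cong_AE[where g="\<lambda>_. 0"]) auto
    with True show ?thesis by (simp add: d integral_return)
  next
    case False
    then have "has_bochner_integral lborel (\<lambda>x. normal_density 0 \<sigma> x * x\<^sup>2) (\<sigma>\<^sup>2)"
      using normal_moment_even[of \<sigma> 0 1] \<sigma> by (simp add: eval_nat_numeral)
    with False show ?thesis
      by (auto simp: d integrable_real_density integral_real_density has_bochner_integral_iff)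
  qed
  then have *: "integrable M (\<lambda>x. (Y x)\<^sup>2)" "(\<integral>x. (Y x)\<^sup>2 \<partial>M) = \<sigma>\<^sup>2"
    by (auto simp: integrable_distr_eq integral_distr)
  then show "integrable M (\<lambda>x. (Y x)\<^sup>2)" by simp
  show "distr M borel Y = (if (\<integral>x. (Y x)\<^sup>2 \<partial>M) = 0 then return borel 0
          else density lborel (normal_density 0 (sqrt (\<integral>x. (Y x)\<^sup>2 \<partial>M))))"
    using \<sigma> unfolding * d by simp
qed

section \<open>Characteristic function and tail of a centred normal variable\<close>

lemma char_centered_normal:
  assumes "\<sigma> > 0"
  shows "char (density lborel (normal_density 0 \<sigma>)) b = complex_of_real (exp (- (b\<^sup>2 * \<sigma>\<^sup>2) / 2))"
proof -
  interpret N: prob_space "density lborel (normal_density 0 \<sigma>)"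
    by (rule prob_space_normal_density) fact
  have "distributed (density lborel (normal_density 0 \<sigma>)) lborel (\<lambda>x. x) (normal_density 0 \<sigma>)"
    by (auto simp: distributed_def distr_id2)
  then have "distributed (density lborel (normal_density 0 \<sigma>)) lborel (\<lambda>x. (x - 0) / \<sigma>) std_normal_density"
    using assms by (subst (asm) N.normal_standard_normal_convert) auto
  then have eq: "distr (density lborel (normal_density 0 \<sigma>)) lborel (\<lambda>x. x / \<sigma>) = std_normal_distribution"
    by (simp add: distributed_def)
  have "char (density lborel (normal_density 0 \<sigma>)) b = (\<integral>x. iexp ((b * \<sigma>) * (x / \<sigma>)) \<partial>density lborel (normal_density 0 \<sigma>))"
    using assms by (simp add: char_def)
  also have "\<dots> = char std_normal_distribution (b * \<sigma>)"
    unfolding eq[symmetric] char_def by (subst integral_distr) auto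
  finally show ?thesis by (simp add: char_std_normal_distribution power_mult_distrib)
qed

text \<open>Evaluation at 1 suffices, since scalars are absorbed into the linear combinations of the
  process to which this is applied.\<close>

lemma (in prob_space) centered_normal_law_char:
  assumes Y[measurable]: "Y \<in> borel_measurable M" and law: "centered_normal_law M Y"
  shows "(\<integral>x. iexp (Y x) \<partial>M) = complex_of_real (exp (- (\<integral>x. (Y x)\<^sup>2 \<partial>M) / 2))"
proof -
  have nn: "(\<integral>x. (Y x)\<^sup>2 \<partial>M) \<ge> 0" by simp
  have "(\<integral>x. iexp (Y x) \<partial>M) = char (distr M borel Y) 1"
    by (simp add: char_def integral_distr)
  also have "\<dots> = complex_of_real (exp (- (\<integral>x. (Y x)\<^sup>2 \<partial>M) / 2))"
  proof (cases "(\<integral>x. (Y x)\<^sup>2 \<partial>M) = 0")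
    case True
    then show ?thesis
      unfolding centered_normal_law_second_moment(2)[OF assms] by (simp add: char_def integral_return)
  next
    case False
    then have "0 < (\<integral>x. (Y x)\<^sup>2 \<partial>M)" using nn by linarith
    then show ?thesis
      unfolding centered_normal_law_second_moment(2)[OF assms] by (simp add: char_centered_normal)
  qed
  finally show ?thesis .
qed

lemma (in prob_space) centered_normal_law_tail:
  assumes Y[measurable]: "Y \<in> borel_measurable M" and law: "centered_normal_law M Y"
    and pos: "(\<integral>x. (Y x)\<^sup>2 \<partial>M) > 0"
  shows "prob {x \<in> space M. Y x > v} = gauss_tail (v / sqrt (\<integral>x. (Y x)\<^sup>2 \<partial>M))"
proof -
  have "prob {x \<in> space M. Y x > v} = measure (distr M borel Y) {v<..}"
    by (subst measure_distr) (auto intro!: arg_cong[where f=prob])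
  also have "\<dots> = gauss_tail (v / sqrt (\<integral>x. (Y x)\<^sup>2 \<partial>M))"
    unfolding centered_normal_law_second_moment(2)[OF Y law]
    using pos by (simp add: measure_centered_normal_tail)
  finally show ?thesis .
qed

text \<open>Needed for perfectly anticorrelated times, where the sum of the two values is almost
  surely 0.\<close>

lemma (in prob_space) centered_normal_law_tail_degenerate:
  assumes Y[measurable]: "Y \<in> borel_measurable M" and law: "centered_normal_law M Y"
    and pos: "(\<integral>x. (Y x)\<^sup>2 \<partial>M) = 0" and v: "v \<ge> 0"
  shows "prob {x \<in> space M. Y x > v} = 0"
proof -
  have "prob {x \<in> space M. Y x > v} = measure (distr M borel Y) {v<..}"
    by (subst measure_distr) (auto intro!: arg_cong[where f=prob])
  also have "\<dots> = 0"
    unfolding centered_normal_law_second_moment(2)[OF Y law]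
    using pos v by (simp add: measure_return)
  finally show ?thesis .
qed

subsection \<open>Bivariate bounds for a stationary Gaussian process\<close>

text \<open>Only the right limit of \<open>r\<close> at 0 is assumed, because (A1) is a statement
  about positive t and does not see the value \<open>r 0\<close>. The normalisation
  \<open>r 0 = 1\<close> is recovered from path continuity.\<close>

locale stationary_gaussian = prob_space M
  for M :: "'a measure" +
  fixes X :: "real \<Rightarrow> 'a \<Rightarrow> real" and r :: "real \<Rightarrow> real"
  assumes gaussian: "centered_gaussian_process M {0..} X"
    and cov: "\<And>s t. s \<ge> 0 \<Longrightarrow> t \<ge> 0 \<Longrightarrow> expectation (\<lambda>\<omega>. X s \<omega> * X (s + t) \<omega>) = r t"
    and cont: "AE \<omega> in M. continuous_on {0..} (\<lambda>t. X t \<omega>)"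
    and r_at_0: "(r \<longlongrightarrow> 1) (at_right 0)"
begin

section \<open>Second moments and continuity of the covariance function\<close>

lemma X_measurable [measurable]: "t \<ge> 0 \<Longrightarrow> X t \<in> borel_measurable M"
  using gaussian by (auto simp: centered_gaussian_process_def)

lemma normal_sum:
  "finite F \<Longrightarrow> F \<subseteq> {0..} \<Longrightarrow> centered_normal_law M (\<lambda>\<omega>. \<Sum>t\<in>F. c t * X t \<omega>)"
  using gaussian by (simp add: centered_gaussian_process_def)

lemma normal_lincomb:
  assumes "s \<ge> 0" "t \<ge> 0"
  shows "centered_normal_law M (\<lambda>\<omega>. a * X s \<omega> + b * X t \<omega>)"
\<comment> \<open>The Gaussian property is stated with sums over sets of times, in which coinciding
  times merge their coefficients.\<close>
proof (cases "s = t")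
  case True
  have "centered_normal_law M (\<lambda>\<omega>. \<Sum>x\<in>{s}. (\<lambda>_. a + b) x * X x \<omega>)"
    using assms by (intro normal_sum) auto
  with True show ?thesis by (simp add: distrib_right)
next
  case False
  have "centered_normal_law M (\<lambda>\<omega>. \<Sum>x\<in>{s,t}. (\<lambda>x. if x = s then a else b) x * X x \<omega>)"
    using assms by (intro normal_sum) auto
  with False show ?thesis by simp
qed

lemma square_integrable: "s \<ge> 0 \<Longrightarrow> integrable M (\<lambda>\<omega>. (X s \<omega>)\<^sup>2)"
  using centered_normal_law_second_moment(1)[OF _ normal_lincomb[of s s 1 0]] by simp

lemma product_integrable:
  assumes "s \<ge> 0" "t \<ge> 0"
  shows "integrable M (\<lambda>\<omega>. X s \<omega> * X t \<omega>)"
proof (rule Bochner_Integration.integrable_bound)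
  show "integrable M (\<lambda>\<omega>. (X s \<omega>)\<^sup>2 + (X t \<omega>)\<^sup>2)"
    using assms by (intro Bochner_Integration.integrable_add square_integrable)
  have "\<bar>x * y\<bar> \<le> x\<^sup>2 + y\<^sup>2" for x y :: real
  proof -
    have "0 \<le> (\<bar>x\<bar> - \<bar>y\<bar>)\<^sup>2 + x\<^sup>2 + y\<^sup>2" by simp
    then show ?thesis by (simp add: power2_diff abs_mult)
  qed
  then show "AE \<omega> in M. norm (X s \<omega> * X t \<omega>) \<le> norm ((X s \<omega>)\<^sup>2 + (X t \<omega>)\<^sup>2)"
    by auto
qed (use assms in measurable)

lemma second_moment_lincomb:
  assumes "s \<ge> 0" "h \<ge> 0"
  shows "expectation (\<lambda>\<omega>. (a * X s \<omega> + b * X (s + h) \<omega>)\<^sup>2) = (a\<^sup>2 + b\<^sup>2) * r 0 + 2 * a * b * r h"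
proof -
  have "expectation (\<lambda>\<omega>. (a * X s \<omega> + b * X (s + h) \<omega>)\<^sup>2) =
    expectation (\<lambda>\<omega>. a\<^sup>2 * (X s \<omega> * X (s + 0) \<omega>) + b\<^sup>2 * (X (s + h) \<omega> * X (s + h + 0) \<omega>) + 2 * a * b * (X s \<omega> * X (s + h) \<omega>))"
    by (intro Bochner_Integration.integral_cong refl) (simp add: power2_eq_square algebra_simps)
  also have "\<dots> = a\<^sup>2 * r 0 + b\<^sup>2 * r 0 + 2 * a * b * r h"
    using assms product_integrable[of s s] product_integrable[of "s + h" "s + h"] product_integrable[of s "s + h"]
      cov[of s 0] cov[of "s + h" 0] cov[of s h]
    by simp
  finally show ?thesis by (simp add: algebra_simps)
qed

lemma char_lincomb:
  assumes "s \<ge> 0" "h \<ge> 0"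
  shows "(\<integral>\<omega>. iexp (a * X s \<omega> + b * X (s + h) \<omega>) \<partial>M) =
    complex_of_real (exp (- ((a\<^sup>2 + b\<^sup>2) * r 0 + 2 * a * b * r h) / 2))"
  using centered_normal_law_char[OF _ normal_lincomb[of s "s + h" a b]] second_moment_lincomb[OF assms, of a b] assms
  by simp

text \<open>The expectation equals \<open>exp (r h - r 0)\<close>. This expresses \<open>r\<close>
  through a bounded integrand, so that path continuity and dominated convergence give continuity of
  \<open>r\<close> without any uniform integrability of products.\<close>

lemma r_eq_ln_char: "h \<ge> 0 \<Longrightarrow> r h = r 0 + ln (norm (\<integral>\<omega>. iexp (X h \<omega> - X 0 \<omega>) \<partial>M))"
  using char_lincomb[of 0 h "-1" 1] by (simp add: field_simps)

lemma continuous_on_r: "continuous_on {0..} r"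
proof -
  have "continuous_on {0..} (\<lambda>h. \<integral>\<omega>. iexp (X h \<omega> - X 0 \<omega>) \<partial>M)"
  proof (rule continuous_on_sequentiallyI)
    fix u :: "nat \<Rightarrow> real" and a assume u: "\<forall>n. u n \<in> {0..}" "a \<in> {0..}" "u \<longlonglongrightarrow> a"
    show "(\<lambda>n. \<integral>\<omega>. iexp (X (u n) \<omega> - X 0 \<omega>) \<partial>M) \<longlonglongrightarrow> (\<integral>\<omega>. iexp (X a \<omega> - X 0 \<omega>) \<partial>M)"
    proof (rule integral_dominated_convergence[where w="\<lambda>_. 1"])
      show "AE \<omega> in M. (\<lambda>n. iexp (X (u n) \<omega> - X 0 \<omega>)) \<longlonglongrightarrow> iexp (X a \<omega> - X 0 \<omega>)"
        using cont
      proof eventually_elim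
        case (elim \<omega>)
        have "(\<lambda>n. X (u n) \<omega>) \<longlonglongrightarrow> X a \<omega>"
          using continuous_on_tendsto_compose[OF elim u(3)] u by auto
        then show ?case by (auto intro!: tendsto_intros)
      qed
    qed (use u in auto)
  qed
  moreover have "norm (\<integral>\<omega>. iexp (X h \<omega> - X 0 \<omega>) \<partial>M) \<noteq> 0" if "h \<ge> 0" for h
    using char_lincomb[of 0 h "-1" 1] that by (simp add: add.commute)
  ultimately have "continuous_on {0..} (\<lambda>h. r 0 + ln (norm (\<integral>\<omega>. iexp (X h \<omega> - X 0 \<omega>) \<partial>M)))"
    by (intro continuous_intros) auto
  then show ?thesis
    by (rule continuous_on_eq) (rule r_eq_ln_char[symmetric], simp)
qed

lemma r_0: "r 0 = 1"
proof -
  have "(r \<longlongrightarrow> r 0) (at 0 within {0..})"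
    using continuous_on_r unfolding continuous_on by (rule bspec) simp
  then have "(r \<longlongrightarrow> r 0) (at_right 0)"
    by (rule tendsto_within_subset) (rule subsetI, simp)
  with r_at_0 show ?thesis
    using tendsto_unique[OF trivial_limit_at_right_real] by metis
qed

lemma abs_r_le_1: "h \<ge> 0 \<Longrightarrow> \<bar>r h\<bar> \<le> 1"
proof -
  assume h: "h \<ge> 0"
  have "0 \<le> expectation (\<lambda>\<omega>. (1 * X 0 \<omega> + 1 * X (0 + h) \<omega>)\<^sup>2)"
    by (intro Bochner_Integration.integral_nonneg) simp
  then have "0 \<le> 2 + 2 * r h" unfolding second_moment_lincomb[OF order_refl h] r_0 by simp
  moreover have "0 \<le> expectation (\<lambda>\<omega>. (1 * X 0 \<omega> + (-1) * X (0 + h) \<omega>)\<^sup>2)"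
    by (intro Bochner_Integration.integral_nonneg) simp
  then have "0 \<le> 2 - 2 * r h" unfolding second_moment_lincomb[OF order_refl h] r_0 by simp
  ultimately show ?thesis by linarith
qed

lemma prob_exceed: "s \<ge> 0 \<Longrightarrow> prob {\<omega> \<in> space M. X s \<omega> > u} = gauss_tail u"
  using centered_normal_law_tail[OF _ normal_lincomb[of s s 1 0], of u] second_moment_lincomb[of s 0 1 0] r_0 by simp

text \<open>If both values exceed u, their sum exceeds 2u. The sum has variance
  \<open>2 * (1 + r h)\<close>, and the square of the normalised threshold,
  \<open>2 * u^2 / (1 + r h)\<close>, is at least \<open>u^2 * (1 + (1 - r h) / 2)\<close>.\<close>

lemma prob_both_exceed_near:
  assumes s: "s \<ge> 0" and h: "h \<ge> 0" and u: "u \<ge> 1"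
  shows "prob {\<omega> \<in> space M. X s \<omega> > u \<and> X (s + h) \<omega> > u} \<le> 2 * gauss_tail u * exp (- u\<^sup>2 * (1 - r h) / 4)"
proof -
  have r: "-1 \<le> r h" "r h \<le> 1" using abs_r_le_1[OF h] by auto
  have var: "expectation (\<lambda>\<omega>. (1 * X s \<omega> + 1 * X (s + h) \<omega>)\<^sup>2) = 2 * (1 + r h)"
    using second_moment_lincomb[OF s h, of 1 1] r_0 by simp
  have [measurable]: "X s \<in> borel_measurable M" "X (s + h) \<in> borel_measurable M" using s h by auto
  have law: "centered_normal_law M (\<lambda>\<omega>. 1 * X s \<omega> + 1 * X (s + h) \<omega>)"
    using s h by (intro normal_lincomb) auto
  have "prob {\<omega> \<in> space M. X s \<omega> > u \<and> X (s + h) \<omega> > u} \<le> prob {\<omega> \<in> space M. 1 * X s \<omega> + 1 * X (s + h) \<omega> > 2 * u}"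
    by (intro finite_measure_mono) auto
  also have "\<dots> \<le> 2 * gauss_tail u * exp (- u\<^sup>2 * (1 - r h) / 4)"
  \<comment> \<open>Here the sum has variance 0 and cannot be standardised.\<close>
  proof (cases "r h = -1")
    case True
    then have "prob {\<omega> \<in> space M. 1 * X s \<omega> + 1 * X (s + h) \<omega> > 2 * u} = 0"
      using u var by (intro centered_normal_law_tail_degenerate law) auto
    then show ?thesis by (simp add: gauss_tail_nonneg)
  next
    case False
    with r have r': "1 + r h > 0" by auto
    have "prob {\<omega> \<in> space M. 1 * X s \<omega> + 1 * X (s + h) \<omega> > 2 * u} = gauss_tail (2 * u / sqrt (2 * (1 + r h)))"
      unfolding var[symmetric] using var r' by (intro centered_normal_law_tail law) auto
    also have "\<dots> \<le> gauss_tail (u * sqrt (1 + (1 - r h) / 2))"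
    proof (rule gauss_tail_mono)
      have "1 + (1 - r h) / 2 \<le> 2 / (1 + r h)"
      proof -
        have "(1 + (1 - r h) / 2) * (1 + r h) = 2 - (1 - r h)\<^sup>2 / 2"
          by (simp add: power2_eq_square field_simps)
        also have "\<dots> \<le> 2" by simp
        finally show ?thesis using r' by (simp add: pos_le_divide_eq)
      qed
      then have "sqrt (1 + (1 - r h) / 2) \<le> sqrt (2 / (1 + r h))" by simp
      also have "2 / (1 + r h) = 4 / (2 * (1 + r h))" using r' by (simp add: field_simps)
      also have "sqrt (4 / (2 * (1 + r h))) = 2 / sqrt (2 * (1 + r h))"
        by (simp only: real_sqrt_divide real_sqrt_four)
      finally have "u * sqrt (1 + (1 - r h) / 2) \<le> u * (2 / sqrt (2 * (1 + r h)))"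
        using u by (intro mult_left_mono) auto
      then show "u * sqrt (1 + (1 - r h) / 2) \<le> 2 * u / sqrt (2 * (1 + r h))"
        by (simp only: times_divide_eq_right mult.commute[of u 2])
    qed
    also have "\<dots> \<le> 2 * gauss_tail u * exp (- u\<^sup>2 * ((1 - r h) / 2) / 2)"
      using u r by (intro gauss_tail_scale_up) auto
    finally show ?thesis by simp
  qed
  finally show ?thesis .
qed

text \<open>Since \<open>r 0 = 1\<close>, the residual of the regression of \<open>X s\<close> on
  \<open>X (s + h)\<close> is uncorrelated with \<open>X (s + h)\<close>; the mixed term in the
  exponent of the joint characteristic function cancels.\<close>

lemma indep_residual:
  assumes s: "s \<ge> 0" and h: "h \<ge> 0"
  shows "indep_var borel (X (s + h)) borel (\<lambda>\<omega>. X s \<omega> - r h * X (s + h) \<omega>)"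
proof (rule indep_var_if_char_factorizes)
  fix a b
  have 1: "(\<integral>\<omega>. iexp (a * X (s + h) \<omega> + b * (X s \<omega> - r h * X (s + h) \<omega>)) \<partial>M) =
    (\<integral>\<omega>. iexp (b * X s \<omega> + (a - b * r h) * X (s + h) \<omega>) \<partial>M)"
    by (intro Bochner_Integration.integral_cong refl arg_cong[where f=iexp]) (simp add: algebra_simps)
  have 2: "(\<integral>\<omega>. iexp (a * X (s + h) \<omega>) \<partial>M) = (\<integral>\<omega>. iexp (0 * X s \<omega> + a * X (s + h) \<omega>) \<partial>M)"
    by simp
  have 3: "(\<integral>\<omega>. iexp (b * (X s \<omega> - r h * X (s + h) \<omega>)) \<partial>M) = (\<integral>\<omega>. iexp (b * X s \<omega> + (- b * r h) * X (s + h) \<omega>) \<partial>M)"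
    by (intro Bochner_Integration.integral_cong refl arg_cong[where f=iexp]) (simp add: algebra_simps)
  show "(\<integral>\<omega>. iexp (a * X (s + h) \<omega> + b * (X s \<omega> - r h * X (s + h) \<omega>)) \<partial>M) =
    (\<integral>\<omega>. iexp (a * X (s + h) \<omega>) \<partial>M) * (\<integral>\<omega>. iexp (b * (X s \<omega> - r h * X (s + h) \<omega>)) \<partial>M)"
    unfolding 1 2 3 char_lincomb[OF s h] of_real_mult[symmetric] exp_add[symmetric] r_0
    by (intro arg_cong[where f="\<lambda>x. complex_of_real (exp x)"]) (simp add: power2_eq_square field_simps)
qed (use s h in auto)

lemma residual_law:
  assumes s: "s \<ge> 0" and h: "h \<ge> 0"
  shows "centered_normal_law M (\<lambda>\<omega>. X s \<omega> - r h * X (s + h) \<omega>)"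
    and "expectation (\<lambda>\<omega>. (X s \<omega> - r h * X (s + h) \<omega>)\<^sup>2) = 1 - (r h)\<^sup>2"
  using normal_lincomb[of s "s + h" 1 "- r h"] second_moment_lincomb[OF s h, of 1 "- r h"] s h r_0
  by (simp_all add: power2_eq_square algebra_simps)

text \<open>The summand \<open>- 1\<close> absorbs the difference between strict and weak inequalities.\<close>
lemma prob_upcrossing:
  assumes s: "s \<ge> 0" and h: "h \<ge> 0" and r: "0 \<le> r h" "r h < 1"
  shows "prob {\<omega> \<in> space M. X (s + h) \<omega> > v \<and> X s \<omega> \<le> v - d} \<le>
     gauss_tail v * gauss_tail (((d - (1 - r h) * v) / sqrt (1 - (r h)\<^sup>2)) - 1)"
proof -
  define Z where "Z = (\<lambda>\<omega>. X s \<omega> - r h * X (s + h) \<omega>)"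
  define w where "w = d - (1 - r h) * v"
  have [measurable]: "X s \<in> borel_measurable M" "X (s + h) \<in> borel_measurable M" using s h by auto
  have [measurable]: "Z \<in> borel_measurable M" unfolding Z_def by measurable
  have pos: "1 - (r h)\<^sup>2 > 0"
    using r by (auto simp: power2_eq_square intro: order_le_less_trans[OF mult_left_le])
  have sq: "sqrt (1 - (r h)\<^sup>2) > 0" using pos by simp
  have neg: "centered_normal_law M (\<lambda>\<omega>. - Z \<omega>)" "expectation (\<lambda>\<omega>. (- Z \<omega>)\<^sup>2) = 1 - (r h)\<^sup>2"
    using normal_lincomb[of s "s + h" "-1" "r h"] residual_law(2)[OF s h] s h by (simp_all add: Z_def power2_commute)
  \<comment> \<open>On this event \<open>Z <= v - d - r h * v = - w\<close>, where
    \<open>r h >= 0\<close> is used. The two resulting conditions are independent.\<close>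
  have "prob {\<omega> \<in> space M. X (s + h) \<omega> > v \<and> X s \<omega> \<le> v - d} \<le>
    prob ((X (s + h) -` {v<..} \<inter> space M) \<inter> (Z -` {..- w} \<inter> space M))"
  proof (intro finite_measure_mono subsetI)
    fix \<omega> assume "\<omega> \<in> {\<omega> \<in> space M. X (s + h) \<omega> > v \<and> X s \<omega> \<le> v - d}"
    then have *: "\<omega> \<in> space M" "X (s + h) \<omega> > v" "X s \<omega> \<le> v - d" by auto
    then have "r h * v \<le> r h * X (s + h) \<omega>" using r by (intro mult_left_mono) auto
    with * show "\<omega> \<in> (X (s + h) -` {v<..} \<inter> space M) \<inter> (Z -` {..- w} \<inter> space M)"
      by (auto simp: Z_def w_def algebra_simps)
  qed auto
  also have "\<dots> = prob (X (s + h) -` {v<..} \<inter> space M) * prob (Z -` {..- w} \<inter> space M)"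
  proof -
    have "(X (s + h) -` {v<..} \<inter> space M) \<inter> (Z -` {..- w} \<inter> space M) =
      (\<lambda>\<omega>. (X (s + h) \<omega>, Z \<omega>)) -` ({v<..} \<times> {..- w}) \<inter> space M" by auto
    then show ?thesis
      using indep_varD[OF indep_residual[OF s h], of "{v<..}" "{..-w}"] by (simp only: Z_def) simp
  qed
  also have "prob (X (s + h) -` {v<..} \<inter> space M) = gauss_tail v"
    using prob_exceed[of "s + h" v] s h by (simp add: vimage_def Int_def conj_commute)
  also have "prob (Z -` {..- w} \<inter> space M) \<le> prob {\<omega> \<in> space M. - Z \<omega> > w - sqrt (1 - (r h)\<^sup>2)}"
  proof (intro finite_measure_mono subsetI)
    fix \<omega> assume "\<omega> \<in> Z -` {..- w} \<inter> space M"
    then have "\<omega> \<in> space M" "Z \<omega> \<le> - w" by auto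
    moreover from this sq have "w - sqrt (1 - (r h)\<^sup>2) < - Z \<omega>" by linarith
    ultimately show "\<omega> \<in> {\<omega> \<in> space M. - Z \<omega> > w - sqrt (1 - (r h)\<^sup>2)}" by simp
  qed auto
  also have "\<dots> = gauss_tail ((w - sqrt (1 - (r h)\<^sup>2)) / sqrt (1 - (r h)\<^sup>2))"
    using centered_normal_law_tail[OF _ neg(1), of "w - sqrt (1 - (r h)\<^sup>2)"] neg(2) pos by simp
  also have "\<dots> = gauss_tail (w / sqrt (1 - (r h)\<^sup>2) - 1)"
    using sq by (simp add: diff_divide_distrib)
  finally show ?thesis by (simp add: w_def mult_left_mono gauss_tail_nonneg)
qed

text \<open>Since \<open>2 r x y \<le> \<bar>r\<bar> (x\<^sup>2 + y\<^sup>2)\<close>, the bivariate density is at most a constant close to 1 times the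
  density of two independent normal variables of variance \<open>1 + \<bar>r\<bar>\<close>.\<close>
lemma prob_both_exceed_far:
  assumes s: "s \<ge> 0" and h: "h \<ge> 0" and r: "\<bar>r h\<bar> < 1"
  shows "prob {\<omega> \<in> space M. X s \<omega> > u \<and> X (s + h) \<omega> > u} \<le>
     (1 + \<bar>r h\<bar>) / sqrt (1 - (r h)\<^sup>2) * (gauss_tail (u / sqrt (1 + \<bar>r h\<bar>)))\<^sup>2"
proof -
  define \<rho> where "\<rho> = r h"
  define Z where "Z = (\<lambda>\<omega>. X s \<omega> - \<rho> * X (s + h) \<omega>)"
  define \<sigma> where "\<sigma> = sqrt (1 - \<rho>\<^sup>2)"
  define \<tau> where "\<tau> = sqrt (1 + \<bar>\<rho>\<bar>)"
  have [measurable]: "X s \<in> borel_measurable M" "X (s + h) \<in> borel_measurable M" using s h by auto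
  have [measurable]: "Z \<in> borel_measurable M" unfolding Z_def by measurable
  have \<rho>1: "\<rho>\<^sup>2 < 1" using r by (simp add: \<rho>_def abs_square_less_1)
  have pos: "1 - \<rho>\<^sup>2 > 0" "\<sigma> > 0" "\<tau> > 0" "\<sigma>\<^sup>2 = 1 - \<rho>\<^sup>2" "\<tau>\<^sup>2 = 1 + \<bar>\<rho>\<bar>"
    using \<rho>1 by (auto simp: \<sigma>_def \<tau>_def)
  have dZ: "distr M borel Z = density lborel (normal_density 0 \<sigma>)"
    using centered_normal_law_second_moment(2)[OF _ residual_law(1)[OF s h]] residual_law(2)[OF s h] pos
    by (simp add: Z_def \<rho>_def \<sigma>_def)
  have dX: "distr M borel (X (s + h)) = density lborel (normal_density 0 1)"
    using centered_normal_law_second_moment(2)[OF _ normal_lincomb[of "s + h" "s + h" 1 0]] second_moment_lincomb[of "s + h" 0 1 0] s h r_0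
    by simp
  \<comment> \<open>The left side is the joint density of \<open>X (s + h)\<close> and
    \<open>X s\<close> at (x, y), written as marginal times conditional. The exponents are compared
    by means of \<open>1 - \<rho>\<^sup>2 = (1 - \<bar>\<rho>\<bar>) * (1 +
    \<bar>\<rho>\<bar>)\<close>; the factor \<open>\<tau>\<^sup>2 / \<sigma>\<close> is the quotient
    of the normalising constants.\<close>
  have dens: "normal_density 0 1 x * normal_density 0 \<sigma> (y - \<rho> * x) \<le> (\<tau>\<^sup>2 / \<sigma>) * (normal_density 0 \<tau> x * normal_density 0 \<tau> y)" for x y
  proof -
    have "2 * \<rho> * x * y \<le> \<bar>\<rho>\<bar> * (x\<^sup>2 + y\<^sup>2)"
    proof -
      have "2 * \<rho> * x * y \<le> \<bar>\<rho>\<bar> * (2 * \<bar>x\<bar> * \<bar>y\<bar>)"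
        using abs_ge_self[of "2 * \<rho> * x * y"] by (simp add: abs_mult mult_ac)
      also have "2 * \<bar>x\<bar> * \<bar>y\<bar> \<le> x\<^sup>2 + y\<^sup>2"
        using sum_squares_bound[of "\<bar>x\<bar>" "\<bar>y\<bar>"] by simp
      finally show ?thesis by (simp add: mult_left_mono)
    qed
    then have le: "(1 - \<bar>\<rho>\<bar>) * (x\<^sup>2 + y\<^sup>2) \<le> x\<^sup>2 * (1 - \<rho>\<^sup>2) + (y - \<rho> * x)\<^sup>2"
      by (simp add: power2_eq_square algebra_simps)
    have half: "a / (2 * b) = a / b / 2" for a b :: real by simp
    have halves: "b + e \<le> a + d \<Longrightarrow> - (a / 2) + - (d / 2) \<le> - (b / 2) + - (e / 2)" for a b d e :: real by simp
    from le have "(1 - \<bar>\<rho>\<bar>) * (x\<^sup>2 + y\<^sup>2) / (1 - \<rho>\<^sup>2) \<le> x\<^sup>2 + (y - \<rho> * x)\<^sup>2 / (1 - \<rho>\<^sup>2)"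
      using pos by (simp add: divide_simps)
    also have "(1 - \<bar>\<rho>\<bar>) * (x\<^sup>2 + y\<^sup>2) / (1 - \<rho>\<^sup>2) = (x\<^sup>2 + y\<^sup>2) / (1 + \<bar>\<rho>\<bar>)"
    proof -
      have "1 - \<rho>\<^sup>2 = (1 - \<bar>\<rho>\<bar>) * (1 + \<bar>\<rho>\<bar>)" by (simp add: power2_eq_square algebra_simps)
      moreover have "1 - \<bar>\<rho>\<bar> \<noteq> 0" using r by (simp add: \<rho>_def)
      ultimately show ?thesis by simp
    qed
    finally have "exp (- x\<^sup>2 / 2 + - (y - \<rho> * x)\<^sup>2 / (2 * \<sigma>\<^sup>2)) \<le> exp (- x\<^sup>2 / (2 * \<tau>\<^sup>2) + - y\<^sup>2 / (2 * \<tau>\<^sup>2))"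
      unfolding pos exp_le_cancel_iff half minus_divide_left[symmetric] add_divide_distrib by (rule halves)
    then have e1: "1 / (2 * pi * \<sigma>) * exp (- x\<^sup>2 / 2 + - (y - \<rho> * x)\<^sup>2 / (2 * \<sigma>\<^sup>2)) \<le>
      1 / (2 * pi * \<sigma>) * exp (- x\<^sup>2 / (2 * \<tau>\<^sup>2) + - y\<^sup>2 / (2 * \<tau>\<^sup>2))"
      using pos by (intro mult_left_mono) auto
    have pi: "sqrt 2 * (sqrt pi * (sqrt 2 * sqrt pi)) = 2 * pi"
    proof -
      have "sqrt 2 * (sqrt pi * (sqrt 2 * sqrt pi)) = (sqrt 2 * sqrt 2) * (sqrt pi * sqrt pi)"
        by (simp only: mult_ac)
      then show ?thesis by simp
    qed
    have e2: "normal_density 0 1 x * normal_density 0 \<sigma> (y - \<rho> * x) = 1 / (2 * pi * \<sigma>) * exp (- x\<^sup>2 / 2 + - (y - \<rho> * x)\<^sup>2 / (2 * \<sigma>\<^sup>2))"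
      using pos(2) by (simp only: normal_density_def exp_add) (simp add: real_sqrt_mult pi)
    have e3: "(\<tau>\<^sup>2 / \<sigma>) * (normal_density 0 \<tau> x * normal_density 0 \<tau> y) = 1 / (2 * pi * \<sigma>) * exp (- x\<^sup>2 / (2 * \<tau>\<^sup>2) + - y\<^sup>2 / (2 * \<tau>\<^sup>2))"
      using pos(2,3) by (simp only: normal_density_def exp_add) (simp add: real_sqrt_mult power2_eq_square pi)
    show ?thesis unfolding e2 e3 by (rule e1)
  qed
  \<comment> \<open>The joint exceedance in the independent coordinates \<open>X (s + h)\<close> and
    \<open>Z\<close>. The shift z = y - \<rho> x later turns it back into a product of half
    lines.\<close>
  define E :: "(real \<times> real) set" where "E = {p. fst p > u \<and> snd p + \<rho> * fst p > u}"
  have E[measurable]: "E \<in> sets (borel \<Otimes>\<^sub>M borel)"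
    unfolding E_def borel_prod by (intro borel_open open_Collect_conj open_Collect_less continuous_intros)
  have E': "E \<in> sets (distr M borel (X (s + h)) \<Otimes>\<^sub>M distr M borel Z)"
    using E sets_pair_measure_cong[of "distr M borel (X (s + h))" borel "distr M borel Z" borel] by simp
  have [measurable]: "(\<lambda>x. \<integral>\<^sup>+z. ennreal (normal_density 0 \<sigma> z) * indicator E (x, z) \<partial>lborel) \<in> borel_measurable borel"
    by measurable
  have sf: "sigma_finite_measure (distr M borel Z)"
    by (intro finite_measure.sigma_finite_measure finite_measure_distr) (auto simp: finite_measure_axioms)
  have "emeasure M {\<omega> \<in> space M. X s \<omega> > u \<and> X (s + h) \<omega> > u} =
    emeasure (distr M (borel \<Otimes>\<^sub>M borel) (\<lambda>\<omega>. (X (s + h) \<omega>, Z \<omega>))) E"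
    by (subst emeasure_distr[OF _ E]) (auto intro!: arg_cong[where f="emeasure M"] simp: Z_def E_def)
  also have "\<dots> = emeasure (distr M borel (X (s + h)) \<Otimes>\<^sub>M distr M borel Z) E"
    using indep_residual[OF s h] unfolding indep_var_distribution_eq by (simp add: Z_def \<rho>_def)
  also have "\<dots> = (\<integral>\<^sup>+x. \<integral>\<^sup>+z. indicator E (x, z) \<partial>distr M borel Z \<partial>distr M borel (X (s + h)))"
    by (rule sigma_finite_measure.emeasure_pair_measure[OF sf E'])
  also have "\<dots> = (\<integral>\<^sup>+x. ennreal (normal_density 0 1 x) * (\<integral>\<^sup>+z. ennreal (normal_density 0 \<sigma> z) * indicator E (x, z) \<partial>lborel) \<partial>lborel)"
    unfolding dZ dX by (subst nn_integral_density; simp add: nn_integral_density)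
  also have "\<dots> = (\<integral>\<^sup>+x. ennreal (normal_density 0 1 x) * (\<integral>\<^sup>+y. ennreal (normal_density 0 \<sigma> (y - \<rho> * x)) * (indicator {u<..} x * indicator {u<..} y) \<partial>lborel) \<partial>lborel)"
  proof (rule nn_integral_cong, rule arg_cong2[where f="(*)"], rule refl)
    fix x :: real
    show "(\<integral>\<^sup>+z. ennreal (normal_density 0 \<sigma> z) * indicator E (x, z) \<partial>lborel) =
      (\<integral>\<^sup>+y. ennreal (normal_density 0 \<sigma> (y - \<rho> * x)) * (indicator {u<..} x * indicator {u<..} y) \<partial>lborel)"
      by (subst nn_integral_real_affine[where c=1 and t="- \<rho> * x"])
         (auto intro!: nn_integral_cong simp: E_def split: split_indicator)
  qed
  also have "\<dots> = (\<integral>\<^sup>+x. \<integral>\<^sup>+y. ennreal (normal_density 0 1 x * normal_density 0 \<sigma> (y - \<rho> * x)) * (indicator {u<..} x * indicator {u<..} y) \<partial>lborel \<partial>lborel)"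
    by (subst nn_integral_cmult[symmetric]) (auto simp: ennreal_mult mult.assoc)
  also have "\<dots> \<le> (\<integral>\<^sup>+x. \<integral>\<^sup>+y. ennreal ((\<tau>\<^sup>2 / \<sigma>) * (normal_density 0 \<tau> x * normal_density 0 \<tau> y)) * (indicator {u<..} x * indicator {u<..} y) \<partial>lborel \<partial>lborel)"
    by (intro nn_integral_mono mult_right_mono ennreal_leI dens) auto
  also have "\<dots> = (\<integral>\<^sup>+x. \<integral>\<^sup>+y. (ennreal (\<tau>\<^sup>2 / \<sigma>) * (ennreal (normal_density 0 \<tau> x) * indicator {u<..} x)) * (ennreal (normal_density 0 \<tau> y) * indicator {u<..} y) \<partial>lborel \<partial>lborel)"
    using pos by (intro nn_integral_cong) (subst ennreal_mult, auto simp: ennreal_mult mult_ac)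
  also have "\<dots> = (\<integral>\<^sup>+x. (ennreal (\<tau>\<^sup>2 / \<sigma>) * (ennreal (normal_density 0 \<tau> x) * indicator {u<..} x)) * emeasure (density lborel (normal_density 0 \<tau>)) {u<..} \<partial>lborel)"
    by (subst nn_integral_cmult) (auto simp: emeasure_density)
  also have "\<dots> = ennreal (\<tau>\<^sup>2 / \<sigma>) * emeasure (density lborel (normal_density 0 \<tau>)) {u<..} * emeasure (density lborel (normal_density 0 \<tau>)) {u<..}"
    by (subst nn_integral_multc, simp, subst nn_integral_cmult) (auto simp: emeasure_density)
  also have "emeasure (density lborel (normal_density 0 \<tau>)) {u<..} = ennreal (gauss_tail (u / \<tau>))"
  proof -
    interpret N: prob_space "density lborel (normal_density 0 \<tau>)" by (rule prob_space_normal_density) (rule pos)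
    show ?thesis by (simp add: N.emeasure_eq_measure measure_centered_normal_tail pos)
  qed
  finally have "emeasure M {\<omega> \<in> space M. X s \<omega> > u \<and> X (s + h) \<omega> > u} \<le> ennreal (\<tau>\<^sup>2 / \<sigma> * (gauss_tail (u / \<tau>))\<^sup>2)"
    using pos(2,3) by (simp add: ennreal_mult[symmetric] gauss_tail_nonneg power2_eq_square mult.assoc)
  then have "prob {\<omega> \<in> space M. X s \<omega> > u \<and> X (s + h) \<omega> > u} \<le> \<tau>\<^sup>2 / \<sigma> * (gauss_tail (u / \<tau>))\<^sup>2"
    using pos by (simp add: emeasure_eq_measure ennreal_le_iff)
  then show ?thesis using pos(5) by (simp add: \<rho>_def \<sigma>_def \<tau>_def)
qed

end

subsection \<open>The maximum over a unit interval\<close>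

definition exceed_scale :: "real \<Rightarrow> real \<Rightarrow> real" where
  "exceed_scale \<alpha> u = u powr ((\<alpha> - 2) / \<alpha>) * exp (u\<^sup>2 / 2)"

lemma exceed_scale_pos: "u > 0 \<Longrightarrow> exceed_scale \<alpha> u > 0"
  by (simp add: exceed_scale_def)


text \<open>The origin of the scale: the left side is the Mills approximation of
  \<open>gauss_tail u\<close> divided by the mesh \<open>u powr (- 2 / \<alpha>)\<close>.\<close>

lemma density_exceed_scale:
  assumes "u > 0" "\<alpha> > 0"
  shows "std_normal_density u / u * u powr (2 / \<alpha>) = 1 / (sqrt (2 * pi) * exceed_scale \<alpha> u)"
proof -
  have "u powr ((\<alpha> - 2) / \<alpha>) = u / u powr (2 / \<alpha>)"
    using assms by (simp add: diff_divide_distrib powr_diff)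
  then show ?thesis
    using assms by (simp add: exceed_scale_def std_normal_density_def exp_minus field_simps)
qed

text \<open>Lowering the threshold by c / u costs only a constant factor, because
  \<open>(u - c / u)^2 >= u^2 - 2 * c\<close>. One factor 2 comes from the new threshold being at
  least u / 2, the other from the Mills ratio.\<close>

lemma gauss_tail_shift:
  assumes "u \<ge> 1" "c \<ge> 0" "u\<^sup>2 \<ge> 2 * c"
  shows "gauss_tail (u - c / u) \<le> 4 * exp c * gauss_tail u"
proof -
  have u: "u > 0" using assms by simp
  have "c / u \<le> u / 2" using assms u by (simp add: field_simps power2_eq_square)
  then have v: "u - c / u \<ge> u / 2" "u - c / u > 0" using u by linarith+
  have "(u - c / u)\<^sup>2 = u\<^sup>2 - 2 * c + (c / u)\<^sup>2" using u by (simp add: power2_diff)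
  then have "u\<^sup>2 - 2 * c \<le> (u - c / u)\<^sup>2" by simp
  then have "std_normal_density (u - c / u) \<le> 1 / sqrt (2 * pi) * exp (- u\<^sup>2 / 2 + c)"
    unfolding std_normal_density_def by (intro mult_left_mono) auto
  also have "\<dots> = std_normal_density u * exp c"
    unfolding std_normal_density_def exp_add by simp
  finally have d: "std_normal_density (u - c / u) \<le> std_normal_density u * exp c" .
  have "gauss_tail (u - c / u) \<le> std_normal_density (u - c / u) / (u - c / u)"
    using v(2) by (rule gauss_tail_upper)
  also have "\<dots> \<le> (std_normal_density u * exp c) / (u / 2)"
    using v(1) u d by (intro frac_le) auto
  also have "\<dots> = 2 * exp c * (std_normal_density u / u)" by simp
  also have "\<dots> \<le> 2 * exp c * (2 * gauss_tail u)"
    using assms by (intro mult_left_mono density_le_gauss_tail) auto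
  finally show ?thesis by simp
qed

text \<open>In the chaining, \<open>2 ^ n\<close> counts the new points of a level, and the tail at
  a geometrically growing argument bounds the conditional probability for each of them.\<close>

lemma summable_gauss_tail_geometric:
  assumes "c > 0" "\<gamma> > 1"
  shows "summable (\<lambda>n. 2 ^ n * gauss_tail (c * \<gamma> ^ n - 1))"
proof (rule summable_comparison_test_ev)
  \<comment> \<open>Chosen so that \<open>(\<gamma> ^ n) powr p = 4 ^ n\<close>: any power of
    \<open>\<gamma> ^ n\<close> is beaten by the Gaussian factor, and \<open>4 ^ n\<close> leaves
    the summable bound \<open>(1/2) ^ n\<close>.\<close>
  define p where "p = ln 4 / ln \<gamma>"
  have lg: "ln \<gamma> > 0" using assms by simp
  have "((\<lambda>y. exp (- (c * y - 1)\<^sup>2 / 2) * y powr p) \<longlongrightarrow> 0) at_top"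
    using assms by real_asymp
  moreover have "filterlim (\<lambda>n. \<gamma> ^ n) at_top sequentially"
    using assms by real_asymp
  ultimately have "((\<lambda>n. exp (- (c * \<gamma> ^ n - 1)\<^sup>2 / 2) * (\<gamma> ^ n) powr p) \<longlongrightarrow> 0) sequentially"
    by (rule filterlim_compose)
  then have "\<forall>\<^sub>F n in sequentially. exp (- (c * \<gamma> ^ n - 1)\<^sup>2 / 2) * (\<gamma> ^ n) powr p < 1"
    by (rule order_tendstoD) simp
  moreover have "filterlim (\<lambda>n. c * \<gamma> ^ n) at_top sequentially"
    using assms by real_asymp
  then have "\<forall>\<^sub>F n in sequentially. c * \<gamma> ^ n \<ge> 2"
    by (simp add: filterlim_at_top)
  ultimately show "\<forall>\<^sub>F n in sequentially. norm (2 ^ n * gauss_tail (c * \<gamma> ^ n - 1)) \<le> (1/2) ^ n"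
  proof eventually_elim
    case (elim n)
    define x where "x = c * \<gamma> ^ n - 1"
    have x: "x \<ge> 1" using elim by (simp add: x_def)
    have "(\<gamma> ^ n) powr p = exp (real n * ln 4)"
      using assms lg by (simp add: powr_def ln_realpow p_def)
    also have "\<dots> = 4 ^ n" by (metis exp_of_nat_mult exp_ln zero_less_numeral)
    finally have g: "(\<gamma> ^ n) powr p = 4 ^ n" .
    have "gauss_tail x \<le> std_normal_density x / x" using x by (intro gauss_tail_upper) simp
    also have "\<dots> \<le> std_normal_density x / 1" using x by (intro divide_left_mono) auto
    also have "\<dots> \<le> 1 * exp (- x\<^sup>2 / 2)"
    proof -
      have "1 \<le> sqrt (2 * pi)" using pi_gt3 by simp
      then show ?thesis unfolding std_normal_density_def by (simp add: divide_le_eq)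
    qed
    finally have "gauss_tail x * 4 ^ n \<le> exp (- x\<^sup>2 / 2) * 4 ^ n"
      by (intro mult_right_mono) auto
    also have "\<dots> \<le> 1" using elim(1) by (simp add: g x_def)
    finally have "2 ^ n * gauss_tail x * 2 ^ n \<le> 1"
      using power_mult_distrib[of "2::real" 2 n] by (simp add: mult_ac)
    then have "2 ^ n * gauss_tail x \<le> 1 / 2 ^ n" by (simp add: pos_le_divide_eq)
    then show ?case by (simp add: x_def gauss_tail_nonneg power_one_over)
  qed
qed simp

text \<open>Of (A1) only the two-sided order of 1 - r is kept: the upper bound controls increments
  in the chaining, the lower bound decouples nearby grid points in the second moment.\<close>

locale pickands_gaussian = stationary_gaussian M X r
  for M :: "'a measure" and X :: "real \<Rightarrow> 'a \<Rightarrow> real" and r :: "real \<Rightarrow> real" +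
  fixes \<alpha> C \<delta> :: real
  assumes \<alpha>: "\<alpha> > 0" and C: "C > 0" and \<delta>: "\<delta> > 0"
    and r_near: "\<And>t. 0 < t \<Longrightarrow> t \<le> \<delta> \<Longrightarrow> C / 2 * t powr \<alpha> \<le> 1 - r t \<and> 1 - r t \<le> 2 * C * t powr \<alpha>"
begin

text \<open>At this lag 1 - r is of order \<open>1 / u^2\<close>, the scale on which exceedances of
  u at two times begin to decouple.\<close>

definition step :: "real \<Rightarrow> real" where "step u = u powr (- 2 / \<alpha>)"

lemma step_pos: "u > 0 \<Longrightarrow> step u > 0"
  by (simp add: step_def)

lemma step_powr: "u > 0 \<Longrightarrow> step u powr \<alpha> = 1 / u\<^sup>2"
proof -
  assume u: "u > 0"
  have "- 2 / \<alpha> * \<alpha> = - 2" using \<alpha> by simp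
  then show ?thesis using u powr_minus[of u 2] by (simp only: step_def powr_powr) (simp add: divide_inverse)
qed

lemma step_tendsto_0: "(step \<longlongrightarrow> 0) at_top"
  unfolding step_def using \<alpha> by real_asymp

text \<open>Only countably many times of the interval from a to \<open>a + step u\<close> are
  inspected, so this is an event; along continuous paths no exceedance is missed, see
  \<open>exceed_imp_dyadic_exceed\<close>.\<close>

definition dyadic_exceed :: "real \<Rightarrow> real \<Rightarrow> 'a set" where
  "dyadic_exceed a u = {\<omega> \<in> space M. \<exists>n k. k \<le> 2 ^ n \<and> X (a + step u * real k / 2 ^ n) \<omega> > u}"

lemma dyadic_exceed_measurable [measurable]:
  assumes "a \<ge> 0" "u > 0" shows "dyadic_exceed a u \<in> sets M"
proof -
  have [measurable]: "X (a + step u * real k / 2 ^ n) \<in> borel_measurable M" for k n :: nat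
    using assms step_pos[of u] by (intro X_measurable) auto
  show ?thesis unfolding dyadic_exceed_def by measurable
qed

text \<open>Chaining with thresholds \<open>u - c 2\<^bsup>-n\<alpha>/4\<^esup> / u\<close>. A dyadic point exceeding its threshold either
  descends from an endpoint exceeding the lowest threshold, or there is a first level at which its
  parent stays below the parent's threshold; the latter has probability at most that of an exceedance
  times a factor that is superexponentially small in the level.\<close>
lemma prob_dyadic_exceed:
  obtains K u0 where "u0 \<ge> 1" "K \<ge> 0"
    "\<And>u a. u \<ge> u0 \<Longrightarrow> a \<ge> 0 \<Longrightarrow> prob (dyadic_exceed a u) \<le> K * gauss_tail u"
proof -
  \<comment> \<open>At level n the value 1 - r is of order \<open>\<rho> ^ (4 * n) / u^2\<close>, so
    the residual has standard deviation of order \<open>\<rho> ^ (2 * n) / u\<close>. Drops of order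
    \<open>\<rho> ^ n / u\<close> are summable and still exceed it by the growing factor
    \<open>(1 / \<rho>) ^ n\<close>.\<close>
  define \<rho> where "\<rho> = 2 powr (- \<alpha> / 4)"
  \<comment> \<open>Makes the threshold drop from level n + 1 to level n equal to
    \<open>4 * C * \<rho> ^ n / u\<close>, twice the bound on the shift of the conditional
    mean.\<close>
  define c where "c = 4 * C / (1 - \<rho>)"
  \<comment> \<open>The argument is the remaining drop \<open>2 * C * \<rho> ^ n / u\<close> over
    the bound \<open>2 * sqrt C * \<rho> ^ (2 * n) / u\<close> for the standard deviation, less the
    1 lost in \<open>prob_upcrossing\<close>.\<close>
  define g where "g n = gauss_tail (sqrt C * (1 / \<rho>) ^ n - 1)" for n
  define S where "S = (\<Sum>n. 2 ^ n * g n)"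
  have \<rho>: "0 < \<rho>" "\<rho> < 1" using \<alpha> by (auto simp: \<rho>_def powr_less_one)
  have c: "c > 0" using C \<rho> by (simp add: c_def)
  have summ: "summable (\<lambda>n. 2 ^ n * g n)"
    unfolding g_def using C \<rho> by (intro summable_gauss_tail_geometric) auto
  have S: "S \<ge> 0" unfolding S_def using summ by (intro suminf_nonneg) (auto simp: g_def gauss_tail_nonneg)
  obtain u1 where u1: "\<And>u. u \<ge> u1 \<Longrightarrow> step u \<le> \<delta>"
    using order_tendstoD(2)[OF step_tendsto_0 \<delta>] unfolding eventually_at_top_linorder by (meson less_imp_le)
  \<comment> \<open>The entries ensure, in turn, \<open>u >= 1\<close>, that the local bounds on r
    apply up to lag \<open>step u\<close>, that the lowered thresholds stay nonnegative, and that r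
    is nonnegative at these lags.\<close>
  define u0 where "u0 = Max {1, u1, sqrt (2 * c), sqrt (2 * C)}"
  have u0: "u0 \<ge> 1" "u0 \<ge> u1" "u0 \<ge> sqrt (2 * c)" "u0 \<ge> sqrt (2 * C)" by (auto simp: u0_def)
  show thesis
  proof (rule that)
    show "u0 \<ge> 1" by (rule u0)
    \<comment> \<open>The 2 stands for the two endpoints and S for all levels of the chain, each
      relative to the lowest threshold \<open>v 0 = u - c / u\<close>; \<open>4 * exp c\<close> is
      the cost of passing from \<open>v 0\<close> back to u.\<close>
    show "4 * exp c * (2 + S) \<ge> 0" using S by simp
    fix u a :: real assume u: "u \<ge> u0" and a: "a \<ge> 0"
    have u_pos: "u \<ge> 1" "u > 0" using u u0 by auto
    have u2: "u\<^sup>2 \<ge> 2 * c" "u\<^sup>2 \<ge> 2 * C"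
      using u u0 by (auto intro!: sqrt_le_D)
    define q where "q = step u"
    have q: "q > 0" "q \<le> \<delta>" using u u0 u1 u_pos step_pos by (auto simp: q_def)
    define v where "v n = u - c * \<rho> ^ n / u" for n
    define t where "t n k = a + q * real k / 2 ^ n" for n k :: nat
    have t0: "t n k \<ge> 0" for n k using a q by (simp add: t_def)
    have [measurable]: "X (t n k) \<in> borel_measurable M" for n k using t0 by auto
    have [measurable]: "X (t n k + q / 2 ^ m) \<in> borel_measurable M" for n k m using t0 q by auto
    define E where "E n j = {\<omega> \<in> space M. X (t n j + q / 2 ^ Suc n) \<omega> > v (Suc n) \<and> X (t n j) \<omega> \<le> v n}" for n j
    have Em[measurable]: "E n j \<in> sets M" for n j unfolding E_def by measurable
    have v_mono: "v n \<le> v (Suc n)" for n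
      using \<rho> c u_pos by (simp add: v_def divide_right_mono mult_left_le_one_le)
    have v_less: "v n < u" for n using \<rho> c u_pos by (simp add: v_def)
    have v0_le: "v 0 \<le> v n" for n by (induction n) (use v_mono order_trans in blast)+
    have incl: "\<omega> \<in> {\<omega> \<in> space M. X a \<omega> > v 0} \<union> {\<omega> \<in> space M. X (a + q) \<omega> > v 0} \<union> (\<Union>n. \<Union>j<2^n. E n j)"
      if "\<omega> \<in> space M" "k \<le> 2 ^ n" "X (t n k) \<omega> > v n" for \<omega> n k
      using that
    proof (induction n arbitrary: k)
      case 0
      then have "k = 0 \<or> k = 1" by auto
      with 0 show ?case by (auto simp: t_def)
    next
      case (Suc n)
      show ?case
      \<comment> \<open>An even index is already a point of level n. An odd one is new, and its
        parent is the left neighbour at distance \<open>q / 2 ^ Suc n\<close>.\<close>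
      proof (cases "even k")
        case True
        then obtain j where k: "k = 2 * j" by blast
        then have "t (Suc n) k = t n j" by (simp add: t_def)
        with Suc.prems v_mono[of n] have "X (t n j) \<omega> > v n" by simp
        moreover have "j \<le> 2 ^ n" using Suc.prems k by simp
        ultimately show ?thesis using Suc.IH Suc.prems by blast
      next
        case False
        then obtain j where k: "k = 2 * j + 1" by (rule oddE)
        then have tk: "t (Suc n) k = t n j + q / 2 ^ Suc n"
          by (simp add: t_def field_simps)
        have j: "j < 2 ^ n" using Suc.prems k by simp
        show ?thesis
        proof (cases "X (t n j) \<omega> > v n")
          case True
          then show ?thesis using Suc.IH[of j] Suc.prems j by simp
        next
          case False
          then have "\<omega> \<in> E n j" using Suc.prems tk by (simp add: E_def)
          then show ?thesis using j by blast
        qed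
      qed
    qed
    have probE: "prob (E n j) \<le> gauss_tail (v 0) * g n" for n j
    proof -
      define h where "h = q / 2 ^ Suc n"
      have h: "h > 0" "h \<le> q" using q one_le_power[of "2::real" "Suc n"] by (auto simp: h_def divide_le_eq simp del: power_Suc)
      \<comment> \<open>Uses \<open>step u powr \<alpha> = 1 / u\<^sup>2\<close> and
        \<open>\<rho> ^ 4 = 2 powr (- \<alpha>)\<close>.\<close>
      have h2: "h powr \<alpha> = \<rho> ^ (4 * Suc n) / u\<^sup>2"
      proof -
        have "\<rho> ^ 4 = 2 powr (- \<alpha>)" unfolding \<rho>_def by (subst powr_power) auto
        then have "\<rho> ^ (4 * Suc n) = 2 powr (- (\<alpha> * real (Suc n)))"
          unfolding power_mult by (simp only:) (subst powr_power, auto simp: algebra_simps)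
        moreover have "(2 ^ Suc n) powr \<alpha> = 2 powr (real (Suc n) * \<alpha>)"
          by (subst powr_realpow[symmetric]) (simp_all add: powr_powr del: power_Suc)
        moreover have "h powr \<alpha> = (1 / u\<^sup>2) / (2 ^ Suc n) powr \<alpha>"
          using q u_pos by (simp add: h_def powr_divide q_def step_powr del: power_Suc)
        ultimately show ?thesis
          by (simp only: powr_minus mult.commute[of \<alpha>]) (simp add: divide_inverse del: power_Suc)
      qed
      have r: "C / 2 * h powr \<alpha> \<le> 1 - r h" "1 - r h \<le> 2 * C * h powr \<alpha>"
        using r_near[of h] h q by auto
      have "0 < C / 2 * h powr \<alpha>" using C h by simp
      then have r1: "r h < 1" using r by linarith
      have rho_le: "\<rho> ^ (4 * Suc n) \<le> \<rho> ^ n" "\<rho> ^ (4 * Suc n) \<le> \<rho> ^ (4 * n)" "\<rho> ^ (4 * Suc n) \<le> 1"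
        using \<rho> by (intro power_decreasing power_le_one; simp)+
      have "2 * C * h powr \<alpha> \<le> 2 * C * (1 / u\<^sup>2)"
        unfolding h2 using C rho_le by (intro mult_left_mono divide_right_mono) auto
      also have "\<dots> \<le> 1" using u2 u_pos by simp
      finally have r0: "r h \<ge> 0" using r by simp
      have d: "v n = v (Suc n) - 4 * C * \<rho> ^ n / u"
      proof -
        have "c * \<rho> ^ n - c * \<rho> ^ Suc n = (c * (1 - \<rho>)) * \<rho> ^ n" by (simp add: algebra_simps)
        also have "c * (1 - \<rho>) = 4 * C" using \<rho> by (simp add: c_def)
        finally have "c * \<rho> ^ n = c * \<rho> ^ Suc n + 4 * C * \<rho> ^ n" by simp
        then show ?thesis unfolding v_def by (simp only: add_divide_distrib diff_diff_eq)
      qed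
      have v_nn: "v (Suc n) \<ge> 0"
      proof -
        have "c * \<rho> ^ Suc n \<le> c * 1"
          using \<rho> c by (intro mult_left_mono power_le_one) auto
        also have "c * 1 \<le> u * u" using u2(1) c unfolding power2_eq_square by linarith
        finally have "c * \<rho> ^ Suc n \<le> u * u" .
        then show ?thesis using u_pos by (simp add: v_def divide_le_eq del: power_Suc)
      qed
      \<comment> \<open>The shift of the conditional mean; it consumes at most half of the threshold
        drop.\<close>
      have "(1 - r h) * v (Suc n) \<le> (2 * C * (\<rho> ^ n / u\<^sup>2)) * u"
      proof (rule mult_mono)
        have "1 - r h \<le> 2 * C * h powr \<alpha>" by (rule r)
        also have "\<dots> \<le> 2 * C * (\<rho> ^ n / u\<^sup>2)"
          unfolding h2 using C rho_le by (intro mult_left_mono divide_right_mono) auto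
        finally show "1 - r h \<le> 2 * C * (\<rho> ^ n / u\<^sup>2)" .
        show "v (Suc n) \<le> u" using v_less[of "Suc n"] by simp
      qed (use C \<rho> v_nn in auto)
      also have "\<dots> = 2 * C * \<rho> ^ n / u" using u_pos by (simp add: power2_eq_square)
      finally have num: "2 * C * \<rho> ^ n / u \<le> 4 * C * \<rho> ^ n / u - (1 - r h) * v (Suc n)"
        by simp
      have den: "sqrt (1 - (r h)\<^sup>2) \<le> 2 * sqrt C * (\<rho> ^ (2 * n) / u)"
      proof (rule real_le_lsqrt)
        have "1 - (r h)\<^sup>2 = (1 - r h) * (1 + r h)" by (simp add: power2_eq_square algebra_simps)
        also have "\<dots> \<le> (2 * C * (\<rho> ^ (4 * n) / u\<^sup>2)) * 2"
        proof (rule mult_mono)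
          have "1 - r h \<le> 2 * C * h powr \<alpha>" by (rule r)
          also have "\<dots> \<le> 2 * C * (\<rho> ^ (4 * n) / u\<^sup>2)"
            unfolding h2 using C rho_le by (intro mult_left_mono divide_right_mono) auto
          finally show "1 - r h \<le> 2 * C * (\<rho> ^ (4 * n) / u\<^sup>2)" .
        qed (use C \<rho> r0 r1 in auto)
        also have "\<dots> = (2 * sqrt C * (\<rho> ^ (2 * n) / u))\<^sup>2"
        proof -
          have "(\<rho> ^ (2 * n))\<^sup>2 = \<rho> ^ (4 * n)" by (simp flip: power_mult)
          then show ?thesis using C by (simp add: power_mult_distrib power_divide)
        qed
        finally show "1 - (r h)\<^sup>2 \<le> (2 * sqrt C * (\<rho> ^ (2 * n) / u))\<^sup>2" .
      qed (use C \<rho> u_pos in auto)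
      have den_pos: "sqrt (1 - (r h)\<^sup>2) > 0"
        using r0 r1 by (simp add: abs_square_less_1)
      have "sqrt C * (1 / \<rho>) ^ n = (2 * C * \<rho> ^ n / u) / (2 * sqrt C * (\<rho> ^ (2 * n) / u))"
      proof -
        obtain s where s: "s > 0" "sqrt C = s" "C = s * s" using C by (metis real_sqrt_gt_0_iff real_sqrt_mult_self abs_of_pos)
        have "\<rho> ^ (2 * n) = \<rho> ^ n * \<rho> ^ n" by (simp add: mult_2 power_add)
        then have "(2 * (s * s) * \<rho> ^ n / u) / (2 * s * (\<rho> ^ (2 * n) / u)) = s * (1 / \<rho>) ^ n"
          using u_pos \<rho> s(1) by (simp add: power_one_over)
        then show ?thesis using s by simp
      qed
      also have "\<dots> \<le> (4 * C * \<rho> ^ n / u - (1 - r h) * v (Suc n)) / sqrt (1 - (r h)\<^sup>2)"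
        using C \<rho> u_pos by (intro frac_le num den den_pos order_trans[OF _ num]) auto
      finally have ratio: "sqrt C * (1 / \<rho>) ^ n - 1 \<le> (4 * C * \<rho> ^ n / u - (1 - r h) * v (Suc n)) / sqrt (1 - (r h)\<^sup>2) - 1"
        by simp
      have "prob (E n j) \<le> gauss_tail (v (Suc n)) * gauss_tail ((4 * C * \<rho> ^ n / u - (1 - r h) * v (Suc n)) / sqrt (1 - (r h)\<^sup>2) - 1)"
        unfolding E_def d h_def[symmetric] using t0 h r0 r1 by (intro prob_upcrossing) auto
      also have "\<dots> \<le> gauss_tail (v 0) * g n"
        unfolding g_def by (intro mult_mono gauss_tail_mono v0_le ratio gauss_tail_nonneg)
      finally show ?thesis .
    qed
    define B where "B n = (\<Union>j<2^n. E n j)" for n :: nat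
    have Bm[measurable]: "B n \<in> sets M" for n unfolding B_def by measurable
    have probB: "prob (B n) \<le> gauss_tail (v 0) * (2 ^ n * g n)" for n
    proof -
      have "prob (B n) \<le> (\<Sum>j<2^n. prob (E n j))"
        unfolding B_def by (intro finite_measure_subadditive_finite) auto
      also have "\<dots> \<le> (\<Sum>j<(2::nat)^n. gauss_tail (v 0) * g n)"
        by (intro sum_mono probE)
      finally show ?thesis by (simp add: mult_ac)
    qed
    have sB: "summable (\<lambda>n. prob (B n))"
      by (rule summable_comparison_test'[OF summable_mult[OF summ, of "gauss_tail (v 0)"], of 0]) (use probB in auto)
    have "prob (\<Union>n. B n) \<le> (\<Sum>n. prob (B n))"
      by (intro finite_measure_subadditive_countably sB) auto
    also have "\<dots> \<le> (\<Sum>n. gauss_tail (v 0) * (2 ^ n * g n))"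
      by (intro suminf_le probB sB summable_mult summ)
    also have "\<dots> = gauss_tail (v 0) * S"
      unfolding S_def by (rule suminf_mult[OF summ])
    finally have pB: "prob (\<Union>n. B n) \<le> gauss_tail (v 0) * S" .
    have [measurable]: "X a \<in> borel_measurable M" "X (a + q) \<in> borel_measurable M" using a q by auto
    have "prob (dyadic_exceed a u) \<le> prob ({\<omega> \<in> space M. X a \<omega> > v 0} \<union> {\<omega> \<in> space M. X (a + q) \<omega> > v 0} \<union> (\<Union>n. B n))"
    proof (rule finite_measure_mono)
      show "dyadic_exceed a u \<subseteq> {\<omega> \<in> space M. X a \<omega> > v 0} \<union> {\<omega> \<in> space M. X (a + q) \<omega> > v 0} \<union> (\<Union>n. B n)"
      proof
        fix \<omega> assume "\<omega> \<in> dyadic_exceed a u"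
        then obtain n k where *: "\<omega> \<in> space M" "k \<le> 2 ^ n" "X (t n k) \<omega> > u"
          by (auto simp: dyadic_exceed_def t_def q_def)
        then have "X (t n k) \<omega> > v n" using v_less[of n] by simp
        from incl[OF *(1,2) this] show "\<omega> \<in> {\<omega> \<in> space M. X a \<omega> > v 0} \<union> {\<omega> \<in> space M. X (a + q) \<omega> > v 0} \<union> (\<Union>n. B n)"
          by (simp add: B_def)
      qed
    qed auto
    also have "\<dots> \<le> prob ({\<omega> \<in> space M. X a \<omega> > v 0} \<union> {\<omega> \<in> space M. X (a + q) \<omega> > v 0}) + prob (\<Union>n. B n)"
      by (intro measure_Un_le) auto
    also have "\<dots> \<le> prob {\<omega> \<in> space M. X a \<omega> > v 0} + prob {\<omega> \<in> space M. X (a + q) \<omega> > v 0} + prob (\<Union>n. B n)"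
      by (intro add_right_mono measure_Un_le) auto
    also have "\<dots> \<le> gauss_tail (v 0) * (2 + S)"
      using pB prob_exceed[of a "v 0"] prob_exceed[of "a + q" "v 0"] a q by (simp add: algebra_simps)
    also have "\<dots> \<le> (4 * exp c * gauss_tail u) * (2 + S)"
      using gauss_tail_shift[of u c] u_pos c u2 S by (intro mult_right_mono) (auto simp: v_def)
    finally show "prob (dyadic_exceed a u) \<le> 4 * exp c * (2 + S) * gauss_tail u" by (simp add: mult_ac)
  qed
qed

text \<open>Rounding down to dyadic points of the interval converges to s, and exceeding u is an
  open condition along a continuous path.\<close>

lemma exceed_imp_dyadic_exceed:
  assumes cont: "continuous_on {0..} (\<lambda>t. X t \<omega>)" and \<omega>: "\<omega> \<in> space M" and a: "a \<ge> 0" and u: "u > 0"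
    and s: "a \<le> s" "s \<le> a + step u" "X s \<omega> > u"
  shows "\<omega> \<in> dyadic_exceed a u"
proof -
  define q where "q = step u"
  have q: "q > 0" using u by (simp add: q_def step_pos)
  define y where "y = (s - a) / q"
  have y: "0 \<le> y" "y \<le> 1" using s q by (auto simp: y_def q_def divide_le_eq)
  define k where "k n = nat \<lfloor>y * 2 ^ n\<rfloor>" for n :: nat
  define t where "t n = a + q * real (k n) / 2 ^ n" for n
  have real_k: "real (k n) = of_int \<lfloor>y * 2 ^ n\<rfloor>" for n
    using y by (simp add: k_def)
  have k_le: "k n \<le> 2 ^ n" for n
  proof -
    have "real (k n) \<le> y * 2 ^ n" unfolding real_k by simp
    also have "\<dots> \<le> 1 * 2 ^ n" using y by (intro mult_right_mono) auto
    finally have "real (k n) \<le> real (2 ^ n)" by simp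
    then show ?thesis by (simp only: of_nat_le_iff)
  qed
  have "(\<lambda>n. real (k n) / 2 ^ n) \<longlonglongrightarrow> y"
  proof (rule tendsto_sandwich)
    show "\<forall>\<^sub>F n in sequentially. y - 1 / 2 ^ n \<le> real (k n) / 2 ^ n"
    proof (intro always_eventually allI)
      fix n
      have "y * 2 ^ n - 1 \<le> real (k n)" unfolding real_k by linarith
      then have "(y * 2 ^ n - 1) / 2 ^ n \<le> real (k n) / 2 ^ n" by (intro divide_right_mono) auto
      then show "y - 1 / 2 ^ n \<le> real (k n) / 2 ^ n" by (simp add: diff_divide_distrib)
    qed
    show "\<forall>\<^sub>F n in sequentially. real (k n) / 2 ^ n \<le> y"
      unfolding real_k by (intro always_eventually allI) (simp add: divide_le_eq)
    show "(\<lambda>n. y - 1 / 2 ^ n) \<longlonglongrightarrow> y" by real_asymp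
  qed simp
  then have "(\<lambda>n. a + q * (real (k n) / 2 ^ n)) \<longlonglongrightarrow> a + q * y"
    by (intro tendsto_intros)
  then have "t \<longlonglongrightarrow> s" using q by (simp add: t_def[abs_def] y_def)
  moreover have "t n \<in> {0..}" for n using a q by (simp add: t_def)
  ultimately have "(\<lambda>n. X (t n) \<omega>) \<longlonglongrightarrow> X s \<omega>"
    using continuous_on_tendsto_compose[OF cont, of t s] s a by simp
  then have "\<forall>\<^sub>F n in sequentially. X (t n) \<omega> > u"
    using s by (intro order_tendstoD(1)) auto
  then obtain n where "X (t n) \<omega> > u" by (auto simp: eventually_sequentially)
  with k_le \<omega> show ?thesis unfolding dyadic_exceed_def t_def q_def by blast
qed

lemma rational_exceed_measurable:
  assumes "I \<subseteq> {0..}"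
  shows "{\<omega> \<in> space M. \<exists>s\<in>\<rat> \<inter> I. X s \<omega> > u} \<in> sets M"
proof -
  have "{\<omega> \<in> space M. \<exists>s\<in>\<rat> \<inter> I. X s \<omega> > u} = (\<Union>s\<in>\<rat> \<inter> I. {\<omega> \<in> space M. X s \<omega> > u})"
    by auto
  also have "\<dots> \<in> sets M"
  proof (intro sets.countable_UN'')
    fix s assume "s \<in> \<rat> \<inter> I"
    then have [measurable]: "X s \<in> borel_measurable M" using assms by auto
    show "{\<omega> \<in> space M. X s \<omega> > u} \<in> sets M" by measurable
  qed (auto intro: countable_Int1 countable_rat)
  finally show ?thesis .
qed

text \<open>The unit interval is covered by order \<open>1 / step u\<close> mesh intervals, each
  contributing order \<open>gauss_tail u\<close>. Rational times keep the event countable, which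
  independence from T will also require.\<close>

lemma prob_exceed_unit_interval:
  obtains K u0 where "u0 \<ge> 1" "K \<ge> 0"
    "\<And>u a. u \<ge> u0 \<Longrightarrow> a \<ge> 0 \<Longrightarrow> prob {\<omega> \<in> space M. \<exists>s\<in>\<rat> \<inter> {a..a + 1}. X s \<omega> > u} \<le> K / exceed_scale \<alpha> u"
proof -
  obtain K u1 where K: "u1 \<ge> 1" "K \<ge> 0"
    "\<And>u a. u \<ge> u1 \<Longrightarrow> a \<ge> 0 \<Longrightarrow> prob (dyadic_exceed a u) \<le> K * gauss_tail u"
    by (rule prob_dyadic_exceed) blast
  obtain u2 where u2: "\<And>u. u \<ge> u2 \<Longrightarrow> step u \<le> 1"
    using order_tendstoD(2)[OF step_tendsto_0, of 1] unfolding eventually_at_top_linorder by (meson less_imp_le zero_less_one)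
  show thesis
  proof (rule that)
    show "max u1 u2 \<ge> 1" using K by simp
    show "0 \<le> 3 * K" using K by simp
    fix u a :: real assume u: "u \<ge> max u1 u2" and a: "a \<ge> 0"
    have u': "u \<ge> 1" "u > 0" using u K by auto
    define q where "q = step u"
    have q: "0 < q" "q \<le> 1" using u u' u2 by (auto simp: q_def step_pos)
    \<comment> \<open>The indices up to N include the last, possibly overhanging, mesh interval;
      there are N + 1 of them, at most 2 / q since \<open>q <= 1\<close>.\<close>
    define N where "N = nat \<lfloor>1 / q\<rfloor>"
    have N: "real N + 1 \<le> 2 / q"
    proof -
      have "real N \<le> 1 / q" using q by (simp add: N_def)
      moreover have "1 \<le> 1 / q" using q by simp
      ultimately show ?thesis by simp
    qed
    have D[measurable]: "dyadic_exceed (a + real i * q) u \<in> sets M" for i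
      using a q u' by (intro dyadic_exceed_measurable) auto
    have "prob {\<omega> \<in> space M. \<exists>s\<in>\<rat> \<inter> {a..a + 1}. X s \<omega> > u} \<le> prob (\<Union>i\<le>N. dyadic_exceed (a + real i * q) u)"
    proof (rule finite_measure_mono_AE)
      show "AE \<omega> in M. \<omega> \<in> {\<omega> \<in> space M. \<exists>s\<in>\<rat> \<inter> {a..a + 1}. X s \<omega> > u} \<longrightarrow> \<omega> \<in> (\<Union>i\<le>N. dyadic_exceed (a + real i * q) u)"
        using cont
      proof (eventually_elim, intro impI)
        fix \<omega> assume c: "continuous_on {0..} (\<lambda>t. X t \<omega>)"
          and "\<omega> \<in> {\<omega> \<in> space M. \<exists>s\<in>\<rat> \<inter> {a..a + 1}. X s \<omega> > u}"
        then obtain s where s: "\<omega> \<in> space M" "a \<le> s" "s \<le> a + 1" "X s \<omega> > u" by auto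
        define i where "i = nat \<lfloor>(s - a) / q\<rfloor>"
        have ri: "real i = of_int \<lfloor>(s - a) / q\<rfloor>" using s q by (simp add: i_def)
        have "(s - a) / q \<le> 1 / q" using s q by (intro divide_right_mono) auto
        then have "i \<le> N" unfolding i_def N_def by (intro nat_mono floor_mono)
        have "real i \<le> (s - a) / q" "(s - a) / q \<le> real i + 1" unfolding ri by linarith+
        then have "real i * q \<le> s - a" "s - a \<le> (real i + 1) * q"
          using q by (auto simp: pos_le_divide_eq pos_divide_le_eq)
        then have "\<omega> \<in> dyadic_exceed (a + real i * q) u"
          using s a q u' by (intro exceed_imp_dyadic_exceed[where s=s] c) (auto simp: q_def algebra_simps)
        with \<open>i \<le> N\<close> show "\<omega> \<in> (\<Union>i\<le>N. dyadic_exceed (a + real i * q) u)" by blast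
      qed
    qed auto
    also have "\<dots> \<le> (\<Sum>i\<le>N. prob (dyadic_exceed (a + real i * q) u))"
      by (intro finite_measure_subadditive_finite) auto
    also have "\<dots> \<le> (\<Sum>i\<le>N. K * gauss_tail u)"
      using a q u by (intro sum_mono K) auto
    also have "\<dots> = K * ((real N + 1) * gauss_tail u)" by simp
    also have "\<dots> \<le> K * ((2 / q) * (std_normal_density u / u))"
      using K N q gauss_tail_upper[OF u'(2)] by (intro mult_left_mono mult_mono) (auto simp: gauss_tail_nonneg)
    also have "\<dots> = 2 * K * (std_normal_density u / u * u powr (2 / \<alpha>))"
      using u' by (simp add: q_def step_def powr_minus divide_inverse)
    also have "\<dots> = 2 * K * (1 / (sqrt (2 * pi) * exceed_scale \<alpha> u))"
      using u' \<alpha> by (simp only: density_exceed_scale)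
    also have "\<dots> \<le> 3 * K * (1 / (1 * exceed_scale \<alpha> u))"
    proof -
      have "1 \<le> sqrt (2 * pi)" using pi_gt3 by simp
      then show ?thesis using K u' exceed_scale_pos[of u \<alpha>]
        by (intro mult_mono divide_left_mono mult_right_mono) auto
    qed
    finally show "prob {\<omega> \<in> space M. \<exists>s\<in>\<rat> \<inter> {a..a + 1}. X s \<omega> > u} \<le> 3 * K / exceed_scale \<alpha> u"
      by simp
  qed
qed

end

subsection \<open>Exceedances on a grid\<close>

text \<open>If no event occurs, the counting variable is 0 and deviates from its mean by n p.
  Chebyshev bounds this by the variance over \<open>(n p)^2\<close>, that is by at most
  \<open>S / (n p)^2 - 1\<close>.\<close>

lemma (in prob_space) second_moment_lower_bound:
  fixes A :: "nat \<Rightarrow> 'a set"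
  assumes [measurable]: "\<And>i. A i \<in> events" and p: "\<And>i. prob (A i) = p" "p > 0" and n: "n > 0"
    and S: "(\<Sum>i<n. \<Sum>j<n. prob (A i \<inter> A j)) \<le> S"
  shows "prob (\<Union>i<n. A i) \<ge> 2 - S / (real n * p)\<^sup>2"
proof -
  define f where "f x = (\<Sum>i<n. indicator (A i) x :: real)" for x
  have [measurable]: "f \<in> borel_measurable M" unfolding f_def by measurable
  have ind: "integrable M (indicator B :: 'a \<Rightarrow> real)" if "B \<in> events" for B
    using that by (simp add: emeasure_eq_measure)
  have Ef: "expectation f = real n * p"
    unfolding f_def using p ind by (subst Bochner_Integration.integral_sum) auto
  have f2: "(f x)\<^sup>2 = (\<Sum>i<n. \<Sum>j<n. indicator (A i \<inter> A j) x)" for x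
    unfolding f_def power2_eq_square sum_product by (simp add: indicator_inter_arith)
  have int2: "integrable M (\<lambda>x. (f x)\<^sup>2)"
    unfolding f2 by (intro Bochner_Integration.integrable_sum ind) auto
  have Ef2: "expectation (\<lambda>x. (f x)\<^sup>2) = (\<Sum>i<n. \<Sum>j<n. prob (A i \<inter> A j))"
    unfolding f2 using ind by (subst Bochner_Integration.integral_sum; (subst Bochner_Integration.integral_sum)?; auto intro!: Bochner_Integration.integrable_sum)
  have int1: "integrable M f"
    unfolding f_def by (intro Bochner_Integration.integrable_sum ind) auto
  have np: "real n * p > 0" using n p by simp
  have "1 - prob (\<Union>i<n. A i) = prob (space M - (\<Union>i<n. A i))"
    by (subst prob_compl) auto
  also have "\<dots> \<le> prob {x \<in> space M. real n * p \<le> \<bar>f x - expectation f\<bar>}"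
  proof (rule finite_measure_mono)
    show "space M - (\<Union>i<n. A i) \<subseteq> {x \<in> space M. real n * p \<le> \<bar>f x - expectation f\<bar>}"
    proof
      fix x assume x: "x \<in> space M - (\<Union>i<n. A i)"
      then have "f x = 0" unfolding f_def by (intro sum.neutral) auto
      with x np show "x \<in> {x \<in> space M. real n * p \<le> \<bar>f x - expectation f\<bar>}"
        by (simp add: Ef)
    qed
  qed measurable
  also have "\<dots> \<le> variance f / (real n * p)\<^sup>2"
    using int2 np by (intro Chebyshev_inequality) auto
  also have "variance f = expectation (\<lambda>x. (f x)\<^sup>2) - (real n * p)\<^sup>2"
    using variance_eq[OF int1 int2] by (simp add: Ef)
  also have "\<dots> \<le> S - (real n * p)\<^sup>2" using S by (simp add: Ef2)
  finally have "1 - prob (\<Union>i<n. A i) \<le> (S - (real n * p)\<^sup>2) / (real n * p)\<^sup>2"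
    using np by (simp add: divide_right_mono)
  also have "\<dots> = S / (real n * p)\<^sup>2 - 1"
    using n p(2) by (simp add: diff_divide_distrib)
  finally show ?thesis by simp
qed

text \<open>By truncated subtraction \<open>(i - j) + (j - i)\<close> is the distance of i and j,
  and every distance occurs at most twice for fixed i.\<close>

lemma sum_lag_le:
  fixes s :: "nat \<Rightarrow> real"
  assumes nonneg: "\<And>k. 0 \<le> s k" and B: "\<And>m. (\<Sum>k<m. s k) \<le> B"
  shows "(\<Sum>j<n. s ((i - j) + (j - i))) \<le> 2 * B"
proof -
  have "(\<Sum>j<n. s ((i - j) + (j - i))) \<le> (\<Sum>j\<in>{..<Suc i} \<union> {i..<i + n}. s ((i - j) + (j - i)))"
    by (intro sum_mono2) (auto simp: nonneg)
  also have "\<dots> \<le> (\<Sum>j<Suc i. s ((i - j) + (j - i))) + (\<Sum>j\<in>{i..<i + n}. s ((i - j) + (j - i)))"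
    by (subst sum_Un) (auto intro!: sum_nonneg mult_nonneg_nonneg nonneg)
  also have "(\<Sum>j<Suc i. s ((i - j) + (j - i))) = (\<Sum>k<Suc i. s k)"
    by (rule sum.reindex_bij_witness[where i="\<lambda>k. i - k" and j="\<lambda>j. i - j"]) auto
  also have "(\<Sum>j\<in>{i..<i + n}. s ((i - j) + (j - i))) = (\<Sum>k<n. s k)"
    by (rule sum.reindex_bij_witness[where i="\<lambda>k. i + k" and j="\<lambda>j. j - i"]) auto
  finally show ?thesis using B[of "Suc i"] B[of n] by linarith
qed

locale berman_gaussian = pickands_gaussian +
  assumes r_less_1: "\<And>t. t > 0 \<Longrightarrow> r t < 1"
    and r_ln: "((\<lambda>t. r t * ln t) \<longlongrightarrow> 0) at_top"
begin

text \<open>Turns the pointwise bound \<open>r t < 1\<close> into a uniform one: continuity on a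
  compact interval, and decay from (A3) beyond it.\<close>

lemma r_gap:
  obtains \<eta> where "\<eta> > 0" "\<And>t. t \<ge> \<delta> \<Longrightarrow> 1 - r t \<ge> \<eta>"
proof -
  have "\<forall>\<^sub>F t in at_top. \<bar>r t * ln t\<bar> < 1/2"
    using tendstoD[OF r_ln, of "1/2"] by (simp add: dist_real_def)
  then obtain T where T: "\<And>t. t \<ge> T \<Longrightarrow> \<bar>r t * ln t\<bar> < 1/2"
    unfolding eventually_at_top_linorder by blast
  \<comment> \<open>\<open>exp 1\<close> gives \<open>ln t >= 1\<close>, so that smallness of
    \<open>r t * ln t\<close> bounds \<open>r t\<close>; \<open>\<delta>\<close> makes the compact
    interval nonempty.\<close>
  define T' where "T' = max (max T (exp 1)) \<delta>"
  have far: "r t \<le> 1/2" if "t \<ge> T'" for t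
  proof (rule ccontr)
    assume "\<not> r t \<le> 1/2"
    then have "1/2 < r t" by simp
    moreover have "1 \<le> ln t"
    proof -
      have "exp 1 \<le> t" using that by (simp add: T'_def)
      then show ?thesis using ln_ge_iff[of t 1] exp_gt_zero[of "1::real"] by linarith
    qed
    ultimately have "1/2 * 1 < r t * ln t" by (intro mult_less_le_imp_less) auto
    moreover have "\<bar>r t * ln t\<bar> < 1/2" using that by (intro T) (simp add: T'_def)
    ultimately show False by simp
  qed
  have "continuous_on {\<delta>..T'} r"
    using \<delta> by (intro continuous_on_subset[OF continuous_on_r]) auto
  then obtain x where x: "x \<in> {\<delta>..T'}" "\<And>t. t \<in> {\<delta>..T'} \<Longrightarrow> r t \<le> r x"
    using continuous_attains_sup[of "{\<delta>..T'}" r] by (auto simp: T'_def)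
  have "r x < 1" using x \<delta> by (intro r_less_1) auto
  show thesis
  proof (rule that[of "min (1 - r x) (1/2)"])
    fix t assume "t \<ge> \<delta>"
    then show "min (1 - r x) (1/2) \<le> 1 - r t"
      using x(2)[of t] far[of t] by (cases "t \<le> T'") auto
  qed (use \<open>r x < 1\<close> in simp)
qed

text \<open>At such lags \<open>ln h >= \<beta> * u^2\<close>, so (A3) yields
  \<open>|r h| <= \<kappa> / u^2\<close>. Inserted into \<open>prob_both_exceed_far\<close>, this
  correlation costs a factor that tends to \<open>exp \<kappa>\<close>.\<close>

lemma far_pair_factor:
  assumes \<beta>: "\<beta> > 0" and \<epsilon>: "\<epsilon> > 0"
  obtains u0 where "u0 \<ge> 1"
    "\<And>u s h. u \<ge> u0 \<Longrightarrow> s \<ge> 0 \<Longrightarrow> h \<ge> exp (\<beta> * u\<^sup>2) \<Longrightarrow>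
      prob {\<omega> \<in> space M. X s \<omega> > u \<and> X (s + h) \<omega> > u} \<le> (1 + \<epsilon>) * (gauss_tail u)\<^sup>2"
proof -
  \<comment> \<open>The half makes the limit \<open>exp \<kappa>\<close> of \<open>F\<close>
    strictly smaller than \<open>1 + \<epsilon>\<close>.\<close>
  define \<kappa> where "\<kappa> = ln (1 + \<epsilon>) / 2"
  have \<kappa>: "\<kappa> > 0" using \<epsilon> by (simp add: \<kappa>_def)
  have "exp \<kappa> < exp (ln (1 + \<epsilon>))" using \<epsilon> by (subst exp_less_cancel_iff) (simp add: \<kappa>_def)
  then have e\<kappa>: "exp \<kappa> < 1 + \<epsilon>" using \<epsilon> by simp
  define F where "F u = (1 + \<kappa> / u\<^sup>2) / sqrt (1 - (\<kappa> / u\<^sup>2)\<^sup>2) * ((1 + 1 / u\<^sup>2) * sqrt (1 + \<kappa> / u\<^sup>2) * exp (\<kappa> / 2))\<^sup>2" for u :: real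
  have "((\<lambda>u. (1 + \<kappa> / u\<^sup>2) / sqrt (1 - (\<kappa> / u\<^sup>2)\<^sup>2) * ((1 + 1 / u\<^sup>2) * sqrt (1 + \<kappa> / u\<^sup>2))\<^sup>2) \<longlongrightarrow> 1) at_top"
    using \<kappa> by real_asymp
  then have "((\<lambda>u. ((1 + \<kappa> / u\<^sup>2) / sqrt (1 - (\<kappa> / u\<^sup>2)\<^sup>2) * ((1 + 1 / u\<^sup>2) * sqrt (1 + \<kappa> / u\<^sup>2))\<^sup>2) * exp \<kappa>) \<longlongrightarrow> 1 * exp \<kappa>) at_top"
    by (intro tendsto_mult tendsto_const)
  moreover have "F = (\<lambda>u. ((1 + \<kappa> / u\<^sup>2) / sqrt (1 - (\<kappa> / u\<^sup>2)\<^sup>2) * ((1 + 1 / u\<^sup>2) * sqrt (1 + \<kappa> / u\<^sup>2))\<^sup>2) * exp \<kappa>)"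
    unfolding F_def power_mult_distrib exp_double[symmetric] by (simp add: mult.assoc)
  ultimately have "(F \<longlongrightarrow> exp \<kappa>) at_top" by (simp only: mult_1)
  then have "\<forall>\<^sub>F u in at_top. F u < 1 + \<epsilon>" using e\<kappa> by (rule order_tendstoD(2))
  then obtain u1 where u1: "\<And>u. u \<ge> u1 \<Longrightarrow> F u < 1 + \<epsilon>"
    unfolding eventually_at_top_linorder by blast
  have "\<forall>\<^sub>F t in at_top. \<bar>r t * ln t\<bar> < \<kappa> * \<beta>"
    using tendstoD[OF r_ln, of "\<kappa> * \<beta>"] \<kappa> \<beta> by (simp add: dist_real_def)
  then obtain T where T: "\<And>t. t \<ge> T \<Longrightarrow> \<bar>r t * ln t\<bar> < \<kappa> * \<beta>"
    unfolding eventually_at_top_linorder by blast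
  have "filterlim (\<lambda>u. exp (\<beta> * u\<^sup>2)) at_top at_top" using \<beta> by real_asymp
  then obtain u2 where u2: "\<And>u. u \<ge> u2 \<Longrightarrow> exp (\<beta> * u\<^sup>2) \<ge> T"
    unfolding filterlim_at_top eventually_at_top_linorder by blast
  have "((\<lambda>u. \<kappa> / u\<^sup>2) \<longlongrightarrow> 0) at_top" by real_asymp
  then have "\<forall>\<^sub>F u in at_top. \<kappa> / u\<^sup>2 < 1" by (rule order_tendstoD) simp
  then obtain u3 where u3: "\<And>u. u \<ge> u3 \<Longrightarrow> \<kappa> / u\<^sup>2 < 1"
    unfolding eventually_at_top_linorder by blast
  define u0 where "u0 = Max {1, u1, u2, u3}"
  have u0: "u0 \<ge> 1" "u0 \<ge> u1" "u0 \<ge> u2" "u0 \<ge> u3" by (auto simp: u0_def)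
  show thesis
  proof (rule that[OF u0(1)])
    fix u s h :: real assume u: "u \<ge> u0" and s: "s \<ge> 0" and h: "h \<ge> exp (\<beta> * u\<^sup>2)"
    have u': "u \<ge> 1" using u u0 by simp
    define x where "x = \<kappa> / u\<^sup>2"
    have x: "0 \<le> x" "x < 1" using \<kappa> u3[of u] u u0 by (auto simp: x_def)
    have h0: "h > 0" using h exp_gt_zero[of "\<beta> * u\<^sup>2"] by linarith
    have lnh: "\<beta> * u\<^sup>2 \<le> ln h" using h h0 ln_ge_iff by blast
    have bu: "\<beta> * u\<^sup>2 > 0" using \<beta> u' by simp
    have "\<bar>r h\<bar> * (\<beta> * u\<^sup>2) \<le> \<bar>r h\<bar> * ln h" using lnh by (intro mult_left_mono) auto
    also have "\<dots> = \<bar>r h * ln h\<bar>" using lnh bu by (simp add: abs_mult)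
    also have "\<dots> \<le> \<kappa> * \<beta>" using T[of h] u2[of u] u u0 h by simp
    finally have "\<bar>r h\<bar> * (u\<^sup>2 * \<beta>) \<le> \<kappa> * \<beta>" by (simp add: mult.commute)
    then have "\<bar>r h\<bar> * u\<^sup>2 \<le> \<kappa>" using \<beta> by simp
    then have rx: "\<bar>r h\<bar> \<le> x" using u' by (simp add: x_def pos_le_divide_eq)
    then have rx2: "(r h)\<^sup>2 \<le> x\<^sup>2" using x by (intro abs_le_square_iff[THEN iffD1]) auto
    have x2: "x\<^sup>2 < 1" using x by (simp add: abs_square_less_1)
    have "prob {\<omega> \<in> space M. X s \<omega> > u \<and> X (s + h) \<omega> > u} \<le>
      (1 + \<bar>r h\<bar>) / sqrt (1 - (r h)\<^sup>2) * (gauss_tail (u / sqrt (1 + \<bar>r h\<bar>)))\<^sup>2"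
      using s h0 rx x by (intro prob_both_exceed_far) auto
    also have "\<dots> \<le> (1 + x) / sqrt (1 - x\<^sup>2) * (gauss_tail (u / sqrt (1 + x)))\<^sup>2"
      using rx rx2 x x2 u' by (intro mult_mono frac_le power_mono gauss_tail_mono divide_left_mono)
        (auto simp: gauss_tail_nonneg)
    also have "\<dots> \<le> (1 + x) / sqrt (1 - x\<^sup>2) * (gauss_tail u * ((1 + 1 / u\<^sup>2) * sqrt (1 + x) * exp (u\<^sup>2 * x / 2)))\<^sup>2"
      using x x2 u' by (intro mult_left_mono power_mono gauss_tail_scale_down) (auto simp: gauss_tail_nonneg)
    also have "\<dots> = F u * (gauss_tail u)\<^sup>2"
    proof -
      have "u\<^sup>2 * x = \<kappa>" using u' by (simp add: x_def)
      then show ?thesis unfolding F_def x_def[symmetric] by (simp add: power_mult_distrib mult_ac)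
    qed
    also have "\<dots> \<le> (1 + \<epsilon>) * (gauss_tail u)\<^sup>2"
      using u1[of u] u u0 by (intro mult_right_mono) auto
    finally show "prob {\<omega> \<in> space M. X s \<omega> > u \<and> X (s + h) \<omega> > u} \<le> (1 + \<epsilon>) * (gauss_tail u)\<^sup>2" .
  qed
qed

lemma summable_exp_neg_powr: "c > 0 \<Longrightarrow> summable (\<lambda>k. exp (- c * real k powr \<alpha>))"
proof (rule summable_comparison_test_ev)
  assume c: "c > 0"
  have "((\<lambda>k. exp (- c * real k powr \<alpha>) * real k ^ 2) \<longlongrightarrow> 0) sequentially"
    using c \<alpha> by real_asymp
  then have "\<forall>\<^sub>F k in sequentially. exp (- c * real k powr \<alpha>) * real k ^ 2 < 1"
    by (rule order_tendstoD) simp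
  then show "\<forall>\<^sub>F k in sequentially. norm (exp (- c * real k powr \<alpha>)) \<le> inverse (real k ^ 2)"
    using eventually_gt_at_top[of 0]
    by eventually_elim (simp add: pos_le_divide_eq inverse_eq_divide)
  show "summable (\<lambda>k. inverse (real k ^ 2))"
    by (rule inverse_power_summable) simp
qed

text \<open>The grid points form clusters: pairs at lag below \<open>exp (\<eta> u\<^sup>2 / 8)\<close> contribute at most a
  constant times the first moment, and pairs at larger lag are asymptotically independent.\<close>
lemma prob_grid_exceed:
  obtains K where "K \<ge> 0"
    "\<And>\<epsilon>. \<epsilon> > 0 \<Longrightarrow> \<exists>u0. \<forall>u\<ge>u0. \<forall>n>0. prob {\<omega> \<in> space M. \<exists>i<n. X (real i * step u) \<omega> > u} \<ge> 1 - \<epsilon> - K / (real n * gauss_tail u)"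
proof -
  obtain \<eta> where \<eta>: "\<eta> > 0" "\<And>t. t \<ge> \<delta> \<Longrightarrow> 1 - r t \<ge> \<eta>" by (rule r_gap) blast
  \<comment> \<open>C / 8 is the C / 2 of the lower bound on 1 - r times the 1 / 4 in the exponent
    of \<open>prob_both_exceed_near\<close>; at lag \<open>k * step u\<close> the powers of u
    cancel.\<close>
  define e where "e k = exp (- (C / 8) * real k powr \<alpha>)" for k :: nat
  have se: "summable e" unfolding e_def using C by (intro summable_exp_neg_powr) auto
  define S where "S = suminf e"
  have S: "S \<ge> 0" unfolding S_def using se by (intro suminf_nonneg) (auto simp: e_def)
  \<comment> \<open>One factor 2 is from \<open>prob_both_exceed_near\<close>, the other from
    counting lags on both sides. The 1 bounds the total contribution of the gap \<eta>.\<close>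
  define K where "K = 4 * (S + 1)"
  \<comment> \<open>The number of lags treated as near. It grows like
    \<open>exp (\<eta> * u^2 / 8)\<close> up to a power of u, so it is outweighed by the factor
    \<open>exp (- u^2 * \<eta> / 4)\<close> that the gap provides.\<close>
  define m where "m u = nat \<lfloor>exp (\<eta> / 8 * u\<^sup>2) / step u\<rfloor> + 1" for u
  have "((\<lambda>u. (exp (\<eta> / 8 * u\<^sup>2) / step u + 1) * exp (- u\<^sup>2 * \<eta> / 4)) \<longlongrightarrow> 0) at_top"
    unfolding step_def using \<eta>(1) \<alpha> by real_asymp
  then have "\<forall>\<^sub>F u in at_top. (exp (\<eta> / 8 * u\<^sup>2) / step u + 1) * exp (- u\<^sup>2 * \<eta> / 4) < 1"
    by (rule order_tendstoD) simp
  then obtain u1 where u1: "\<And>u. u \<ge> u1 \<Longrightarrow> (exp (\<eta> / 8 * u\<^sup>2) / step u + 1) * exp (- u\<^sup>2 * \<eta> / 4) < 1"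
    unfolding eventually_at_top_linorder by blast
  show thesis
  proof (rule that)
    show "K \<ge> 0" using S by (simp add: K_def)
    fix \<epsilon> :: real assume \<epsilon>: "\<epsilon> > 0"
    obtain u2 where u2: "u2 \<ge> 1"
      "\<And>u s h. u \<ge> u2 \<Longrightarrow> s \<ge> 0 \<Longrightarrow> h \<ge> exp (\<eta> / 8 * u\<^sup>2) \<Longrightarrow>
        prob {\<omega> \<in> space M. X s \<omega> > u \<and> X (s + h) \<omega> > u} \<le> (1 + \<epsilon>) * (gauss_tail u)\<^sup>2"
      using far_pair_factor[of "\<eta> / 8" \<epsilon>] \<eta>(1) \<epsilon> by auto
    show "\<exists>u0. \<forall>u\<ge>u0. \<forall>n>0. prob {\<omega> \<in> space M. \<exists>i<n. X (real i * step u) \<omega> > u} \<ge> 1 - \<epsilon> - K / (real n * gauss_tail u)"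
    proof (intro exI[of _ "max u1 u2"] allI impI)
      fix u :: real and n :: nat assume u: "u \<ge> max u1 u2" and n: "n > 0"
      have u': "u \<ge> 1" "u > 0" using u u2 by auto
      define q where "q = step u"
      have q: "q > 0" using u' by (simp add: q_def step_pos)
      define Q where "Q = gauss_tail u"
      have Q: "Q > 0" by (simp add: Q_def gauss_tail_pos)
      \<comment> \<open>The excess allowed over the independent value. Near lags use the sum of both
        bounds, so that no distinction at \<delta> is needed; far lags have no excess.\<close>
      define s where "s k = (if k < m u then 2 * Q * (e k + exp (- u\<^sup>2 * \<eta> / 4)) else 0)" for k
      have s_nn: "s k \<ge> 0" for k using Q by (simp add: s_def e_def)
      have pair: "prob {\<omega> \<in> space M. X t \<omega> > u \<and> X (t + real k * q) \<omega> > u} \<le> (1 + \<epsilon>) * Q\<^sup>2 + s k"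
        if t: "t \<ge> 0" for t k
      proof (cases "k < m u")
        case True
        have "prob {\<omega> \<in> space M. X t \<omega> > u \<and> X (t + real k * q) \<omega> > u} \<le> 2 * Q * exp (- u\<^sup>2 * (1 - r (real k * q)) / 4)"
          unfolding Q_def using t q u' by (intro prob_both_exceed_near) auto
        also have "exp (- u\<^sup>2 * (1 - r (real k * q)) / 4) \<le> e k + exp (- u\<^sup>2 * \<eta> / 4)"
        proof (cases "real k * q \<le> \<delta>")
          case True
          have "u\<^sup>2 * (1 - r (real k * q)) \<ge> C / 2 * real k powr \<alpha>"
          proof (cases "k = 0")
            case False
            then have "C / 2 * (real k * q) powr \<alpha> \<le> 1 - r (real k * q)"
              using r_near[of "real k * q"] True q by simp
            then have "u\<^sup>2 * (C / 2 * (real k * q) powr \<alpha>) \<le> u\<^sup>2 * (1 - r (real k * q))"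
              by (intro mult_left_mono) auto
            moreover have "u\<^sup>2 * (C / 2 * (real k * q) powr \<alpha>) = C / 2 * real k powr \<alpha>"
              using q u' by (simp add: powr_mult q_def step_powr)
            ultimately show ?thesis by (simp only:)
          qed (simp add: r_0)
          then have "exp (- u\<^sup>2 * (1 - r (real k * q)) / 4) \<le> e k" by (simp add: e_def)
          then show ?thesis by (simp add: add_increasing2)
        next
          case False
          then have "u\<^sup>2 * \<eta> \<le> u\<^sup>2 * (1 - r (real k * q))" using \<eta> by (intro mult_left_mono) auto
          then have "exp (- u\<^sup>2 * (1 - r (real k * q)) / 4) \<le> exp (- u\<^sup>2 * \<eta> / 4)" by simp
          moreover have "0 \<le> e k" by (simp add: e_def)
          ultimately show ?thesis by linarith
        qed
        finally have "prob {\<omega> \<in> space M. X t \<omega> > u \<and> X (t + real k * q) \<omega> > u} \<le> s k"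
          using True Q by (simp add: s_def)
        moreover have "0 \<le> (1 + \<epsilon>) * Q\<^sup>2" using \<epsilon> by simp
        ultimately show ?thesis by linarith
      next
        case False
        then have "exp (\<eta> / 8 * u\<^sup>2) / q \<le> real k"
          unfolding m_def q_def[symmetric] by linarith
        then have "exp (\<eta> / 8 * u\<^sup>2) \<le> real k * q" using q by (simp add: pos_divide_le_eq)
        then show ?thesis using u2(2)[of u t "real k * q"] u t s_nn[of k] by (simp add: Q_def)
      qed
      have sum_s: "(\<Sum>k<N. s k) \<le> 2 * Q * (S + 1)" for N
      proof -
        have "(\<Sum>k<N. s k) \<le> (\<Sum>k<max N (m u). s k)"
          by (intro sum_mono2) (auto simp: s_nn)
        also have "\<dots> = (\<Sum>k<m u. s k)"
          by (intro sum.mono_neutral_right) (auto simp: s_def)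
        also have "\<dots> = (\<Sum>k<m u. 2 * Q * (e k + exp (- u\<^sup>2 * \<eta> / 4)))"
          by (intro sum.cong) (auto simp: s_def)
        also have "\<dots> = 2 * Q * ((\<Sum>k<m u. e k) + real (m u) * exp (- u\<^sup>2 * \<eta> / 4))"
          by (simp add: sum_distrib_left[symmetric] sum.distrib)
        also have "\<dots> \<le> 2 * Q * (S + 1)"
        proof (intro mult_left_mono add_mono)
          show "(\<Sum>k<m u. e k) \<le> S"
            unfolding S_def by (intro sum_le_suminf se) (auto simp: e_def)
          have "real (m u) \<le> exp (\<eta> / 8 * u\<^sup>2) / step u + 1"
            using step_pos[OF u'(2)] by (simp add: m_def)
          then have "real (m u) * exp (- u\<^sup>2 * \<eta> / 4) \<le> (exp (\<eta> / 8 * u\<^sup>2) / step u + 1) * exp (- u\<^sup>2 * \<eta> / 4)"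
            by (intro mult_right_mono) auto
          also have "\<dots> \<le> 1" using u1[of u] u by (intro less_imp_le) auto
          finally show "real (m u) * exp (- u\<^sup>2 * \<eta> / 4) \<le> 1" .
        qed (use Q in auto)
        finally show ?thesis .
      qed
      define A where "A i = {\<omega> \<in> space M. X (real i * q) \<omega> > u}" for i :: nat
      have [measurable]: "X (real i * q) \<in> borel_measurable M" for i :: nat using q by auto
      have pairA: "prob (A i \<inter> A j) \<le> (1 + \<epsilon>) * Q\<^sup>2 + s ((i - j) + (j - i))" for i j
      proof -
        have *: "prob (A i \<inter> A j) \<le> (1 + \<epsilon>) * Q\<^sup>2 + s (j - i)" if "i \<le> j" for i j
        proof -
          have "real j * q = real i * q + real (j - i) * q" using that by (simp add: of_nat_diff algebra_simps)
          then have "A i \<inter> A j = {\<omega> \<in> space M. X (real i * q) \<omega> > u \<and> X (real i * q + real (j - i) * q) \<omega> > u}"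
            by (auto simp: A_def)
          then show ?thesis using pair[of "real i * q" "j - i"] q by simp
        qed
        show ?thesis using *[of i j] *[of j i] by (cases "i \<le> j") (auto simp: Int_commute)
      qed
      have "(\<Sum>i<n. \<Sum>j<n. prob (A i \<inter> A j)) \<le> (\<Sum>i<n. \<Sum>j<n. (1 + \<epsilon>) * Q\<^sup>2 + s ((i - j) + (j - i)))"
        by (intro sum_mono pairA)
      also have "\<dots> \<le> (\<Sum>i<n. real n * ((1 + \<epsilon>) * Q\<^sup>2) + 2 * (2 * Q * (S + 1)))"
        unfolding sum.distrib by (intro add_mono sum_mono sum_lag_le s_nn sum_s) simp
      also have "\<dots> = real n ^ 2 * ((1 + \<epsilon>) * Q\<^sup>2) + real n * (K * Q)"
        by (simp add: K_def power2_eq_square algebra_simps)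
      finally have "prob (\<Union>i<n. A i) \<ge> 2 - (real n ^ 2 * ((1 + \<epsilon>) * Q\<^sup>2) + real n * (K * Q)) / (real n * Q)\<^sup>2"
        using Q n q by (intro second_moment_lower_bound) (auto simp: A_def Q_def prob_exceed)
      also have "(real n ^ 2 * ((1 + \<epsilon>) * Q\<^sup>2) + real n * (K * Q)) / (real n * Q)\<^sup>2 = (1 + \<epsilon>) + K / (real n * Q)"
        using Q n by (simp add: power2_eq_square add_divide_distrib)
      finally have "prob (\<Union>i<n. A i) \<ge> 1 - \<epsilon> - K / (real n * Q)" by simp
      moreover have "(\<Union>i<n. A i) = {\<omega> \<in> space M. \<exists>i<n. X (real i * step u) \<omega> > u}"
        by (auto simp: A_def q_def)
      ultimately show "prob {\<omega> \<in> space M. \<exists>i<n. X (real i * step u) \<omega> > u} \<ge> 1 - \<epsilon> - K / (real n * gauss_tail u)"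
        by (simp add: Q_def)
    qed
  qed
qed

end

subsection \<open>Slowly varying tails and the random interval\<close>

text \<open>A Potter bound with exponent 1/2: eventually doubling the argument reduces
  \<open>L\<close> by at most the factor sqrt 2, which the square root makes up for. Iteration
  covers powers of 2 and monotonicity the points between.\<close>

lemma slowly_varying_almost_increasing:
  assumes L: "slowly_varying L" and mono: "antimono L"
  obtains x0 where "x0 \<ge> 1" "L x0 > 0" "\<And>x y. x0 \<le> x \<Longrightarrow> x \<le> y \<Longrightarrow> L x * sqrt x \<le> 2 * (L y * sqrt y)"
proof -
  have lim: "((\<lambda>x. L (2 * x) / L x) \<longlongrightarrow> 1) at_top" and pos: "\<forall>\<^sub>F x in at_top. L x > 0"
    using L by (auto simp: slowly_varying_def)
  have "\<forall>\<^sub>F x in at_top. 1 / sqrt 2 < L (2 * x) / L x"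
    by (rule order_tendstoD(1)[OF lim]) simp
  then have "\<forall>\<^sub>F x in at_top. 1 / sqrt 2 < L (2 * x) / L x \<and> L x > 0"
    using pos by (rule eventually_conj)
  then obtain x1 where x1: "\<And>x. x \<ge> x1 \<Longrightarrow> 1 / sqrt 2 < L (2 * x) / L x \<and> L x > 0"
    unfolding eventually_at_top_linorder by blast
  define x0 where "x0 = max 1 x1"
  have dbl: "L x \<le> sqrt 2 * L (2 * x)" if "x \<ge> x0" for x
  proof -
    have "L x > 0" "1 / sqrt 2 < L (2 * x) / L x" using x1[of x] that by (auto simp: x0_def)
    then show ?thesis by (simp add: field_simps)
  qed
  have pow: "L x \<le> sqrt 2 ^ k * L (2 ^ k * x)" if "x \<ge> x0" for x k
  proof (induction k)
    case (Suc k)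
    have "x0 \<ge> 1" by (simp add: x0_def)
    then have "1 * x \<le> 2 ^ k * x" using that by (intro mult_right_mono) auto
    then have "L (2 ^ k * x) \<le> sqrt 2 * L (2 * (2 ^ k * x))" using that by (intro dbl) simp
    then have "sqrt 2 ^ k * L (2 ^ k * x) \<le> sqrt 2 ^ k * (sqrt 2 * L (2 * (2 ^ k * x)))"
      by (intro mult_left_mono) auto
    from order_trans[OF Suc this] show ?case by (simp add: mult_ac)
  qed simp
  show thesis
  proof (rule that)
    show "x0 \<ge> 1" "L x0 > 0" using x1[of x0] by (auto simp: x0_def)
    fix x y assume xy: "x0 \<le> x" "x \<le> y"
    have x: "x \<ge> 1" "y \<ge> 1" using xy by (auto simp: x0_def)
    have Ly: "L y > 0" using x1[of y] xy by (simp add: x0_def)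
    obtain n where "y / x < 2 ^ n" using real_arch_pow[of 2 "y / x"] by auto
    then have ex: "y \<le> 2 ^ n * x" using x by (simp add: field_simps)
    \<comment> \<open>The least doubling that reaches y overshoots it by at most a factor 2.\<close>
    define k where "k = (LEAST k. y \<le> 2 ^ k * x)"
    have k: "y \<le> 2 ^ k * x" unfolding k_def using ex by (rule LeastI)
    have k2: "2 ^ k * x \<le> 2 * y"
    proof (cases k)
      case (Suc j)
      then have "\<not> y \<le> 2 ^ j * x" using not_less_Least[of j "\<lambda>k. y \<le> 2 ^ k * x"] by (simp add: k_def)
      then show ?thesis by (simp add: Suc)
    qed (use xy x in simp)
    have "L x \<le> sqrt 2 ^ k * L (2 ^ k * x)" using xy by (intro pow)
    also have "\<dots> \<le> sqrt 2 ^ k * L y" using k mono by (intro mult_left_mono) (auto simp: antimono_def)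
    finally have "L x * sqrt x \<le> (sqrt 2 ^ k * L y) * sqrt x" using x by (intro mult_right_mono) auto
    also have "\<dots> = L y * sqrt (2 ^ k * x)" by (simp add: real_sqrt_mult real_sqrt_power)
    also have "\<dots> \<le> L y * sqrt (4 * y)" using Ly k2 x by (intro mult_left_mono) auto
    finally show "L x * sqrt x \<le> 2 * (L y * sqrt y)" by (simp add: real_sqrt_mult)
  qed
qed

text \<open>The increment of the right side dominates the new term because
  \<open>2 * a * b <= a^2 + b^2\<close>. The term for j = 0 is 0 by the convention for division by
  zero.\<close>

lemma sum_inverse_sqrt_le: "(\<Sum>j<Suc n. 1 / sqrt (real j)) \<le> 2 * sqrt (real n)"
proof (induction n)
  case (Suc n)
  define a b where "a = sqrt (real n)" and "b = sqrt (real (Suc n))"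
  have ab: "a \<ge> 0" "b > 0" "b\<^sup>2 = a\<^sup>2 + 1" by (auto simp: a_def b_def)
  have "2 * a * b \<le> a\<^sup>2 + b\<^sup>2" by (rule sum_squares_bound)
  then have "(2 * a) * b + 1 \<le> (2 * b) * b" using ab(3) by (simp add: power2_eq_square)
  then have "2 * a + 1 / b \<le> 2 * b" using ab(2) by (simp add: field_simps)
  with Suc show ?case unfolding sum.lessThan_Suc[of _ "Suc n"] a_def b_def by linarith
qed simp

text \<open>An inequality of Karamata type: beyond \<open>x0\<close> one has
  \<open>L j <= 2 * L y * sqrt (y / j)\<close>, and summing the inverse square roots gives another
  \<open>2 * sqrt y\<close>. The earlier terms are at most 1 each and go into
  \<open>c\<close>.\<close>

lemma slowly_varying_sum_bound:
  assumes L: "slowly_varying L" and mono: "antimono L" and le1: "\<And>x. L x \<le> 1"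
  obtains c y0 where "c \<ge> 0" "\<And>y N. y \<ge> y0 \<Longrightarrow> real N \<le> y \<Longrightarrow> (\<Sum>j<N. L (real j)) \<le> c + 4 * (y * L y)"
proof -
  obtain x0 where x0: "x0 \<ge> 1" "L x0 > 0" "\<And>x y. x0 \<le> x \<Longrightarrow> x \<le> y \<Longrightarrow> L x * sqrt x \<le> 2 * (L y * sqrt y)"
    using slowly_varying_almost_increasing[OF L mono] by blast
  define j0 where "j0 = nat \<lceil>x0\<rceil>"
  have j0: "x0 \<le> real j0" unfolding j0_def by linarith
  show thesis
  proof (rule that)
    show "0 \<le> real j0" by simp
    fix y N assume y: "y \<ge> x0" and N: "real N \<le> y"
    have y1: "y \<ge> 1" using x0 y by simp
    have "L x0 * sqrt x0 \<le> 2 * (L y * sqrt y)" using y by (intro x0) auto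
    moreover have "0 < L x0 * sqrt x0" using x0(1,2) by simp
    ultimately have "0 < L y * sqrt y" by linarith
    then have Ly: "0 < L y" using y1 by (simp add: zero_less_mult_iff)
    have term_le: "L (real j) \<le> (if j < j0 then 1 else 0) + 2 * (L y * sqrt y) * (1 / sqrt (real j))" if "j < N" for j
    proof (cases "j < j0")
      case True
      then show ?thesis using le1[of "real j"] Ly y1 by (simp add: add_increasing2)
    next
      case False
      then have "x0 \<le> real j" using j0 by simp
      then have "L (real j) * sqrt (real j) \<le> 2 * (L y * sqrt y)" using that N by (intro x0) auto
      then show ?thesis using False \<open>x0 \<le> real j\<close> x0(1) by (simp add: pos_le_divide_eq)
    qed
    have "(\<Sum>j<N. L (real j)) \<le> (\<Sum>j<N. (if j < j0 then 1 else 0) + 2 * (L y * sqrt y) * (1 / sqrt (real j)))"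
      by (intro sum_mono term_le) simp
    also have "\<dots> = (\<Sum>j<N. if j < j0 then 1 else 0) + 2 * (L y * sqrt y) * (\<Sum>j<N. 1 / sqrt (real j))"
      unfolding sum.distrib sum_distrib_left ..
    also have "(\<Sum>j<N. if j < j0 then 1 else 0) \<le> (\<Sum>j<max N j0. if j < j0 then 1 else (0::real))"
      by (intro sum_mono2) auto
    also have "\<dots> = (\<Sum>j<j0. 1)"
      by (intro sum.mono_neutral_cong_right) auto
    also have "\<dots> = real j0" by simp
    also have "(\<Sum>j<N. 1 / sqrt (real j)) \<le> (\<Sum>j<Suc N. 1 / sqrt (real j))"
      by (intro sum_mono2) auto
    also have "\<dots> \<le> 2 * sqrt (real N)" by (rule sum_inverse_sqrt_le)
    also have "\<dots> \<le> 2 * sqrt y" using N by simp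
    finally have "(\<Sum>j<N. L (real j)) \<le> real j0 + 2 * (L y * sqrt y) * (2 * sqrt y)"
      using Ly y1 by (simp add: mult_left_mono)
    also have "2 * (L y * sqrt y) * (2 * sqrt y) = 4 * (y * L y)" using y1 by simp
    finally show "(\<Sum>j<N. L (real j)) \<le> real j0 + 4 * (y * L y)" .
  qed
qed

text \<open>Makes errors of order 1 / m negligible compared with the tail of T at m.\<close>

lemma slowly_varying_mult_id_at_top:
  assumes L: "slowly_varying L" and mono: "antimono L"
  shows "filterlim (\<lambda>y. y * L y) at_top at_top"
proof -
  obtain x0 where x0: "x0 \<ge> 1" "L x0 > 0" "\<And>x y. x0 \<le> x \<Longrightarrow> x \<le> y \<Longrightarrow> L x * sqrt x \<le> 2 * (L y * sqrt y)"
    using slowly_varying_almost_increasing[OF L mono] by blast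
  define c where "c = L x0 * sqrt x0 / 2"
  have "c > 0" using x0(1,2) by (simp add: c_def)
  then have "filterlim (\<lambda>y. c * sqrt y) at_top at_top" by real_asymp
  then show ?thesis
  proof (rule filterlim_at_top_mono)
    show "\<forall>\<^sub>F y in at_top. c * sqrt y \<le> y * L y"
      using eventually_ge_at_top[of x0]
    proof eventually_elim
      case (elim y)
      then have "c \<le> L y * sqrt y" using x0(3)[of x0 y] by (simp add: c_def)
      then have "c * sqrt y \<le> L y * sqrt y * sqrt y" using elim x0(1) by (intro mult_right_mono) auto
      also have "\<dots> = y * L y" using elim x0(1) by simp
      finally show ?case .
    qed
  qed
qed

text \<open>Allows the supremum event, which may fail to be measurable, to be replaced by a
  countable version that agrees with it almost everywhere.\<close>

lemma measure_completion_AE_eq: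
  assumes G: "G \<in> sets M" and E: "E \<subseteq> space M" and ae: "AE x in M. x \<in> G \<longleftrightarrow> x \<in> E"
  shows "measure (completion M) E = measure M G"
proof -
  obtain N where N: "{x \<in> space M. \<not> (x \<in> G \<longleftrightarrow> x \<in> E)} \<subseteq> N" "N \<in> null_sets M"
    using ae by (auto simp: eventually_ae_filter)
  have "G \<subseteq> space M" using G by (rule sets.sets_into_space)
  then have "E = (G - N) \<union> (E \<inter> N)" using N(1) E by auto
  then have Es: "E \<in> sets (completion M)"
    by (rule sets_completionI[OF _ _ N(2)]) (use G N(2) in auto)
  have "AE x in completion M. x \<in> E \<longleftrightarrow> x \<in> G"
    using ae by (subst AE_completion_iff) (auto elim: eventually_mono)
  then have "measure (completion M) E = measure (completion M) G"
    using Es G by (intro measure_eq_AE) auto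
  then show ?thesis using G by simp
qed

lemma exceed_scale_at_top:
  assumes "\<alpha> > 0" shows "filterlim (exceed_scale \<alpha>) at_top at_top"
  unfolding exceed_scale_def using assms by real_asymp

section \<open>Separating T from the path, and the event of an exceedance before T\<close>

locale random_interval = berman_gaussian +
  fixes T :: "'a \<Rightarrow> real"
  assumes T_nonneg: "AE \<omega> in M. T \<omega> \<ge> 0"
    and T_measurable [measurable]: "T \<in> borel_measurable M"
    and T_indep: "indep_set (sets (vimage_algebra (space M) T borel))
                  (sets (vimage_algebra (space M) (\<lambda>\<omega>. restrict (\<lambda>t. X t \<omega>) {0::real..})
                                         (Pi\<^sub>M {0::real..} (\<lambda>_. borel))))"
begin

abbreviation \<sigma>X where
  "\<sigma>X \<equiv> vimage_algebra (space M) (\<lambda>\<omega>. restrict (\<lambda>t. X t \<omega>) {0::real..}) (Pi\<^sub>M {0::real..} (\<lambda>_. borel))"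

lemma exceed_in_\<sigma>X: "s \<ge> 0 \<Longrightarrow> {\<omega> \<in> space M. X s \<omega> > u} \<in> sets \<sigma>X"
proof -
  assume s: "s \<ge> 0"
  have "(\<lambda>f. f s) \<in> borel_measurable (Pi\<^sub>M {0::real..} (\<lambda>_. borel :: real measure))"
    using s by (intro measurable_component_singleton) auto
  then have "{f \<in> space (Pi\<^sub>M {0::real..} (\<lambda>_. borel :: real measure)). f s > u} \<in> sets (Pi\<^sub>M {0::real..} (\<lambda>_. borel))"
    by measurable
  then have "(\<lambda>\<omega>. restrict (\<lambda>t. X t \<omega>) {0::real..}) -` {f \<in> space (Pi\<^sub>M {0::real..} (\<lambda>_. borel :: real measure)). f s > u} \<inter> space M \<in> sets \<sigma>X"
    by (rule in_vimage_algebra)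
  moreover have "(\<lambda>\<omega>. restrict (\<lambda>t. X t \<omega>) {0::real..}) -` {f \<in> space (Pi\<^sub>M {0::real..} (\<lambda>_. borel :: real measure)). f s > u} \<inter> space M = {\<omega> \<in> space M. X s \<omega> > u}"
    using s by (auto simp: space_PiM)
  ultimately show ?thesis by simp
qed

lemma exceed_Bex_in_\<sigma>X:
  assumes "countable I" "I \<subseteq> {0..}"
  shows "{\<omega> \<in> space M. \<exists>s\<in>I. X s \<omega> > u} \<in> sets \<sigma>X"
proof -
  have "{\<omega> \<in> space M. \<exists>s\<in>I. X s \<omega> > u} = (\<Union>s\<in>I. {\<omega> \<in> space M. X s \<omega> > u})" by auto
  also have "\<dots> \<in> sets \<sigma>X"
    using assms by (intro sets.countable_UN'' exceed_in_\<sigma>X) auto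
  finally show ?thesis .
qed

text \<open>Independence is given for the product sigma-algebra, which is reached by countable
  unions of conditions on single times; hence the countable index set.\<close>

lemma prob_T_exceed:
  assumes "A \<in> sets borel" "countable I" "I \<subseteq> {0..}"
  shows "prob {\<omega> \<in> space M. T \<omega> \<in> A \<and> (\<exists>s\<in>I. X s \<omega> > u)} =
    prob {\<omega> \<in> space M. T \<omega> \<in> A} * prob {\<omega> \<in> space M. \<exists>s\<in>I. X s \<omega> > u}"
proof -
  have "T -` A \<inter> space M \<in> sets (vimage_algebra (space M) T borel)"
    using assms by (intro in_vimage_algebra)
  then have "{\<omega> \<in> space M. T \<omega> \<in> A} \<in> sets (vimage_algebra (space M) T borel)"
    by (simp add: vimage_def Int_def conj_commute)
  from indep_setD[OF T_indep this exceed_Bex_in_\<sigma>X[OF assms(2,3), of u]] show ?thesis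
    by (simp add: Int_def conj_ac cong: conj_cong)
qed

definition T_tail :: "real \<Rightarrow> real" where "T_tail t = prob {\<omega> \<in> space M. T \<omega> > t}"

lemma T_tail_antimono: "antimono T_tail"
  unfolding T_tail_def by (intro antimonoI finite_measure_mono) auto

lemma T_tail_le_1: "T_tail t \<le> 1"
  by (simp add: T_tail_def)

definition sup_exceed :: "real \<Rightarrow> 'a set" where
  "sup_exceed u = {\<omega> \<in> space M. \<exists>s\<in>\<rat> \<inter> {0..}. s \<le> T \<omega> \<and> X s \<omega> > u}"

lemma sup_exceed_measurable [measurable]: "sup_exceed u \<in> sets M"
proof -
  have "sup_exceed u = (\<Union>s\<in>\<rat> \<inter> {0..}. {\<omega> \<in> space M. s \<le> T \<omega> \<and> X s \<omega> > u})"
    by (auto simp: sup_exceed_def)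
  also have "\<dots> \<in> sets M"
  proof (intro sets.countable_UN'')
    fix s :: real assume "s \<in> \<rat> \<inter> {0..}"
    then have [measurable]: "X s \<in> borel_measurable M" by auto
    show "{\<omega> \<in> space M. s \<le> T \<omega> \<and> X s \<omega> > u} \<in> sets M" by measurable
  qed (auto intro: countable_Int1 countable_rat)
  finally show ?thesis .
qed

text \<open>The rational time is taken to the left of s so that it still lies before T. At s = 0
  there is no room on the left, but 0 is itself rational.\<close>

lemma AE_sup_exceed: "AE \<omega> in M. \<forall>u. \<omega> \<in> sup_exceed u \<longleftrightarrow> (\<exists>s\<in>{0..T \<omega>}. X s \<omega> > u)"
  using cont T_nonneg AE_space
proof eventually_elim
  case (elim \<omega>)
  show ?case
  proof (intro allI iffI)
    fix u assume "\<omega> \<in> sup_exceed u"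
    then show "\<exists>s\<in>{0..T \<omega>}. X s \<omega> > u" by (auto simp: sup_exceed_def)
  next
    fix u assume "\<exists>s\<in>{0..T \<omega>}. X s \<omega> > u"
    then obtain s where s: "0 \<le> s" "s \<le> T \<omega>" "X s \<omega> > u" by auto
    have "\<exists>q\<in>\<rat> \<inter> {0..}. q \<le> T \<omega> \<and> X q \<omega> > u"
    proof (cases "s = 0")
      case True
      with s show ?thesis by (intro bexI[of _ 0]) auto
    next
      case False
      have "continuous_on {0..} (\<lambda>t. X t \<omega>)" by (rule elim)
      then have "((\<lambda>t. X t \<omega>) \<longlongrightarrow> X s \<omega>) (at s within {0..})"
        using s unfolding continuous_on by simp
      then have "\<forall>\<^sub>F t in at s within {0..}. X t \<omega> > u"
        using s by (intro order_tendstoD(1)) auto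
      then obtain d where d: "d > 0" "\<And>t. t \<in> {0..} \<Longrightarrow> t \<noteq> s \<Longrightarrow> dist t s < d \<Longrightarrow> X t \<omega> > u"
        unfolding eventually_at by auto
      have "max 0 (s - d) < s" using False s d by simp
      then obtain q where q: "q \<in> \<rat>" "max 0 (s - d) < q" "q < s" using Rats_dense_in_real by blast
      then have "X q \<omega> > u" by (intro d) (auto simp: dist_real_def)
      with q s show ?thesis by (intro bexI[of _ q]) auto
    qed
    with elim show "\<omega> \<in> sup_exceed u" by (simp add: sup_exceed_def)
  qed
qed

lemma measure_completion_sup_exceed:
  "measure (completion M) {\<omega> \<in> space M. \<exists>s\<in>{0..T \<omega>}. X s \<omega> > u} = prob (sup_exceed u)"
  using AE_sup_exceed AE_space
  by (intro measure_completion_AE_eq) (auto elim: eventually_elim2)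

lemma prob_sup_exceed_lower:
  assumes \<epsilon>: "\<epsilon> > 0"
  shows "\<exists>A>0. \<forall>\<^sub>F u in at_top. prob (sup_exceed u) \<ge> T_tail (A * exceed_scale \<alpha> u) * (1 - 2 * \<epsilon>)"
proof -
  obtain K where K: "K \<ge> 0"
    "\<And>\<epsilon>. \<epsilon> > 0 \<Longrightarrow> \<exists>u0. \<forall>u\<ge>u0. \<forall>n>0. prob {\<omega> \<in> space M. \<exists>i<n. X (real i * step u) \<omega> > u} \<ge> 1 - \<epsilon> - K / (real n * gauss_tail u)"
    by (rule prob_grid_exceed) blast
  obtain u0 where u0: "\<And>u n. u \<ge> u0 \<Longrightarrow> n > 0 \<Longrightarrow>
      prob {\<omega> \<in> space M. \<exists>i<n. X (real i * step u) \<omega> > u} \<ge> 1 - \<epsilon> - K / (real n * gauss_tail u)"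
    using K(2)[OF \<epsilon>] by blast
  \<comment> \<open>The number of grid points times \<open>gauss_tail u\<close> is at least A / 6 -
    1, the 1 coming from rounding n down. \<open>A >= 12\<close> makes this at least A / 12, and the
    second entry makes \<open>12 * K / A\<close> at most \<epsilon>.\<close>
  define A where "A = max 12 (12 * K / \<epsilon>)"
  have A: "A \<ge> 12" "12 * K \<le> A * \<epsilon>"
  proof -
    have "12 * K / \<epsilon> \<le> A" by (simp add: A_def)
    then show "12 * K \<le> A * \<epsilon>" using \<epsilon> by (simp add: pos_divide_le_eq)
  qed (simp add: A_def)
  have "\<forall>\<^sub>F u in at_top. prob (sup_exceed u) \<ge> T_tail (A * exceed_scale \<alpha> u) * (1 - 2 * \<epsilon>)"
    using eventually_ge_at_top[of u0] eventually_ge_at_top[of 1]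
  proof eventually_elim
    case (elim u)
    define m where "m = exceed_scale \<alpha> u"
    define q where "q = step u"
    define Q where "Q = gauss_tail u"
    have pos: "m > 0" "q > 0" "Q > 0" "Q \<le> 1"
      using elim by (auto simp: m_def q_def Q_def exceed_scale_pos step_pos gauss_tail_pos gauss_tail_le_1)
    define n where "n = nat \<lfloor>A * m / q\<rfloor>"
    have Amq: "0 \<le> A * m / q" using A pos by simp
    have n_le: "real n \<le> A * m / q" unfolding n_def using Amq by simp
    have n_ge: "A * m / q - 1 \<le> real n" unfolding n_def using Amq by linarith
    have mQ: "1 / 6 \<le> m * Q / q"
    proof -
      have s3: "sqrt (2 * pi) \<le> 3" using pi_less_4 by (intro real_le_lsqrt) auto
      have "m * (std_normal_density u / u * (1 / q)) = 1 / sqrt (2 * pi)"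
      proof -
        have "1 / q = u powr (2 / \<alpha>)" by (simp add: q_def step_def powr_minus divide_inverse)
        then have "std_normal_density u / u * (1 / q) = 1 / (sqrt (2 * pi) * m)"
          using density_exceed_scale[of u \<alpha>] elim \<alpha> by (simp add: m_def)
        then show ?thesis using pos by simp
      qed
      moreover have "std_normal_density u / u \<le> 2 * Q"
        unfolding Q_def using elim by (intro density_le_gauss_tail)
      then have "m * (std_normal_density u / u * (1 / q)) \<le> m * (2 * Q * (1 / q))"
        using pos by (intro mult_left_mono mult_right_mono) auto
      moreover have "1 / 3 \<le> 1 / sqrt (2 * pi)" using s3 by (intro divide_left_mono) auto
      ultimately have "1 / 3 \<le> m * (2 * Q * (1 / q))" by linarith
      also have "\<dots> = 2 * (m * Q / q)" by simp
      finally show ?thesis by linarith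
    qed
    have "A * (1 / 6) \<le> A * (m * Q / q)" using mQ A by (intro mult_left_mono) auto
    moreover have "(A * m / q - 1) * Q \<le> real n * Q" using n_ge pos by (intro mult_right_mono) auto
    ultimately have nQ: "A / 12 \<le> real n * Q" using A pos by (simp add: algebra_simps)
    then have n: "n > 0" using A by (cases n) auto
    have "K / (real n * Q) \<le> K / (A / 12)" using K nQ A by (intro divide_left_mono) auto
    also have "\<dots> \<le> \<epsilon>" using A by (simp add: pos_divide_le_eq mult.commute)
    finally have pn: "1 - 2 * \<epsilon> \<le> prob {\<omega> \<in> space M. \<exists>i<n. X (real i * q) \<omega> > u}"
      using u0[OF elim(1) n] by (simp add: q_def Q_def)
    \<comment> \<open>These times do not go beyond \<open>A * m\<close>, so on the event that T
      exceeds \<open>A * m\<close> every grid exceedance counts.\<close>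
    define I where "I = (\<lambda>i. real i * q) ` {..<n}"
    have I: "countable I" "I \<subseteq> {0..}" using pos by (auto simp: I_def)
    have "T_tail (A * m) * (1 - 2 * \<epsilon>) \<le> T_tail (A * m) * prob {\<omega> \<in> space M. \<exists>s\<in>I. X s \<omega> > u}"
      using pn by (intro mult_left_mono) (auto simp: T_tail_def I_def Bex_def)
    also have "\<dots> = prob {\<omega> \<in> space M. T \<omega> \<in> {A * m<..} \<and> (\<exists>s\<in>I. X s \<omega> > u)}"
      using I by (subst prob_T_exceed) (auto simp: T_tail_def)
    also have "\<dots> \<le> prob (sup_exceed u)"
    proof (rule finite_measure_mono_AE)
      show "AE \<omega> in M. \<omega> \<in> {\<omega> \<in> space M. T \<omega> \<in> {A * m<..} \<and> (\<exists>s\<in>I. X s \<omega> > u)} \<longrightarrow> \<omega> \<in> sup_exceed u"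
        using AE_sup_exceed
      proof (eventually_elim, intro impI)
        fix \<omega> assume eq: "\<forall>u. \<omega> \<in> sup_exceed u \<longleftrightarrow> (\<exists>s\<in>{0..T \<omega>}. X s \<omega> > u)"
          and "\<omega> \<in> {\<omega> \<in> space M. T \<omega> \<in> {A * m<..} \<and> (\<exists>s\<in>I. X s \<omega> > u)}"
        then obtain i where i: "i < n" "X (real i * q) \<omega> > u" "A * m < T \<omega>" by (auto simp: I_def)
        have "real i * q \<le> real n * q" using i pos by (intro mult_right_mono) auto
        also have "\<dots> \<le> A * m" using n_le pos by (simp add: pos_le_divide_eq)
        finally have "real i * q \<in> {0..T \<omega>}" using i pos by simp
        then show "\<omega> \<in> sup_exceed u" using eq i by blast
      qed
    qed simp
    finally show ?case by (simp add: m_def)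
  qed
  then show ?thesis using A by (intro exI[of _ A]) auto
qed

text \<open>\<open>K\<close> and \<open>c\<close> are obtained before \<epsilon>, because the final
  limit chooses \<epsilon> in terms of \<open>K\<close>.\<close>

lemma prob_sup_exceed_upper:
  assumes slow: "slowly_varying T_tail"
  obtains K c where "K \<ge> 0"
    "\<And>\<epsilon>. \<epsilon> > 0 \<Longrightarrow> \<forall>\<^sub>F u in at_top. prob (sup_exceed u) \<le> T_tail (\<epsilon> * exceed_scale \<alpha> u) * (1 + K * \<epsilon>) + c / exceed_scale \<alpha> u"
proof -
  obtain K u0 where K: "u0 \<ge> 1" "K \<ge> 0"
    "\<And>u a. u \<ge> u0 \<Longrightarrow> a \<ge> 0 \<Longrightarrow> prob {\<omega> \<in> space M. \<exists>s\<in>\<rat> \<inter> {a..a + 1}. X s \<omega> > u} \<le> K / exceed_scale \<alpha> u"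
    by (rule prob_exceed_unit_interval) blast
  obtain c y0 where c: "c \<ge> 0" "\<And>y N. y \<ge> y0 \<Longrightarrow> real N \<le> y \<Longrightarrow> (\<Sum>j<N. T_tail (real j)) \<le> c + 4 * (y * T_tail y)"
    using slowly_varying_sum_bound[OF slow T_tail_antimono T_tail_le_1] by blast
  show thesis
  proof (rule that)
    show "4 * K \<ge> 0" using K by simp
    fix \<epsilon> :: real assume \<epsilon>: "\<epsilon> > 0"
    have "filterlim (\<lambda>u. \<epsilon> * exceed_scale \<alpha> u) at_top at_top"
      using \<epsilon> exceed_scale_at_top[OF \<alpha>] by (intro filterlim_tendsto_pos_mult_at_top[OF tendsto_const])
    then have "\<forall>\<^sub>F u in at_top. y0 \<le> \<epsilon> * exceed_scale \<alpha> u"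
      by (simp add: filterlim_at_top)
    then show "\<forall>\<^sub>F u in at_top. prob (sup_exceed u) \<le> T_tail (\<epsilon> * exceed_scale \<alpha> u) * (1 + (4 * K) * \<epsilon>) + ((1 + c) * K) / exceed_scale \<alpha> u"
      using eventually_ge_at_top[of u0]
    proof eventually_elim
      case (elim u)
      define m where "m = exceed_scale \<alpha> u"
      have m: "m > 0" using elim K by (simp add: m_def exceed_scale_pos)
      define y where "y = \<epsilon> * m"
      have y: "y > 0" "y \<ge> y0" using \<epsilon> m elim by (auto simp: y_def m_def)
      define N where "N = nat \<lfloor>y\<rfloor>"
      have N: "real N \<le> y" using y by (simp add: N_def)
      \<comment> \<open>An exceedance time s in the j-th unit interval with s before T forces
        \<open>T >= j\<close>. Weakening to this condition separates T from the path.\<close>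
      define B where "B j = {\<omega> \<in> space M. T \<omega> \<in> {real j..} \<and> (\<exists>s\<in>\<rat> \<inter> {real j..real j + 1}. X s \<omega> > u)}" for j :: nat
      have I: "countable (\<rat> \<inter> {real j..real j + 1})" "\<rat> \<inter> {real j..real j + 1} \<subseteq> {0..}" for j
        by (auto intro: countable_Int1 countable_rat)
      have Bm[measurable]: "B j \<in> sets M" for j
      proof -
        have "B j = {\<omega> \<in> space M. T \<omega> \<in> {real j..}} \<inter> {\<omega> \<in> space M. \<exists>s\<in>\<rat> \<inter> {real j..real j + 1}. X s \<omega> > u}"
          by (auto simp: B_def)
        also have "\<dots> \<in> sets M"
          by (intro sets.Int rational_exceed_measurable) auto
        finally show ?thesis .
      qed
      have PB: "prob (B j) \<le> prob {\<omega> \<in> space M. T \<omega> \<ge> real j} * (K / m)" for j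
      proof -
        have "prob (B j) = prob {\<omega> \<in> space M. T \<omega> \<in> {real j..}} * prob {\<omega> \<in> space M. \<exists>s\<in>\<rat> \<inter> {real j..real j + 1}. X s \<omega> > u}"
          unfolding B_def using I by (intro prob_T_exceed) auto
        also have "\<dots> \<le> prob {\<omega> \<in> space M. T \<omega> \<in> {real j..}} * (K / m)"
          unfolding m_def using elim by (intro mult_left_mono K) auto
        finally show ?thesis by simp
      qed
      \<comment> \<open>The shift by one converts weak inequalities into strict ones, so that
        \<open>T_tail\<close> applies; the term at 0 is at most 1.\<close>
      have "(\<Sum>j<Suc N. prob {\<omega> \<in> space M. T \<omega> \<ge> real j}) =
        prob {\<omega> \<in> space M. T \<omega> \<ge> real 0} + (\<Sum>j<N. prob {\<omega> \<in> space M. T \<omega> \<ge> real (Suc j)})"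
        by (rule sum.lessThan_Suc_shift)
      also have "\<dots> \<le> 1 + (\<Sum>j<N. T_tail (real j))"
        unfolding T_tail_def by (intro add_mono sum_mono finite_measure_mono) auto
      also have "\<dots> \<le> 1 + (c + 4 * (y * T_tail y))"
        using c(2)[OF y(2) N] by simp
      finally have sumT: "(\<Sum>j<Suc N. prob {\<omega> \<in> space M. T \<omega> \<ge> real j}) \<le> 1 + (c + 4 * (y * T_tail y))" .
      have "prob (sup_exceed u) \<le> prob ({\<omega> \<in> space M. T \<omega> > y} \<union> (\<Union>j<Suc N. B j))"
      proof (rule finite_measure_mono)
        show "sup_exceed u \<subseteq> {\<omega> \<in> space M. T \<omega> > y} \<union> (\<Union>j<Suc N. B j)"
        proof
          fix \<omega> assume "\<omega> \<in> sup_exceed u"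
          then obtain s where s: "\<omega> \<in> space M" "s \<in> \<rat>" "s \<ge> 0" "s \<le> T \<omega>" "X s \<omega> > u"
            by (auto simp: sup_exceed_def)
          show "\<omega> \<in> {\<omega> \<in> space M. T \<omega> > y} \<union> (\<Union>j<Suc N. B j)"
          proof (cases "T \<omega> > y")
            case False
            define j where "j = nat \<lfloor>s\<rfloor>"
            have "j \<le> N" unfolding j_def N_def using False s by (intro nat_mono floor_mono) simp
            moreover have "real j = of_int \<lfloor>s\<rfloor>" using s by (simp add: j_def)
            then have "real j \<le> s" "s \<le> real j + 1" by linarith+
            then have "\<omega> \<in> B j" using s by (auto simp: B_def intro!: bexI[of _ s])
            ultimately show ?thesis by auto
          qed (use s in auto)
        qed
      qed measurable
      also have "\<dots> \<le> T_tail y + prob (\<Union>j<Suc N. B j)"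
        unfolding T_tail_def by (intro measure_Un_le) auto
      also have "prob (\<Union>j<Suc N. B j) \<le> (\<Sum>j<Suc N. prob (B j))"
        by (intro finite_measure_subadditive_finite) auto
      also have "\<dots> \<le> (\<Sum>j<Suc N. prob {\<omega> \<in> space M. T \<omega> \<ge> real j} * (K / m))"
        by (intro sum_mono PB)
      also have "\<dots> = (\<Sum>j<Suc N. prob {\<omega> \<in> space M. T \<omega> \<ge> real j}) * (K / m)"
        by (rule sum_distrib_right[symmetric])
      also have "\<dots> \<le> (1 + (c + 4 * (y * T_tail y))) * (K / m)"
        using sumT K(2) m by (intro mult_right_mono) auto
      finally have "prob (sup_exceed u) \<le> T_tail y + (1 + (c + 4 * (y * T_tail y))) * (K / m)" by simp
      also have "\<dots> = T_tail y * (1 + (4 * K) * \<epsilon>) + ((1 + c) * K) / m"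
        using m by (simp add: y_def field_simps)
      finally show ?case by (simp add: y_def m_def)
    qed
  qed
qed

lemma prob_sup_exceed_asymp:
  assumes slow: "slowly_varying T_tail"
  shows "(\<lambda>u. prob (sup_exceed u)) \<sim>[at_top] (\<lambda>u. T_tail (exceed_scale \<alpha> u))"
proof (rule asymp_equivI')
  define R where "R u = prob (sup_exceed u) / T_tail (exceed_scale \<alpha> u)" for u
  have tail_pos: "\<forall>\<^sub>F u in at_top. T_tail (exceed_scale \<alpha> u) > 0"
    using slow unfolding slowly_varying_def by (intro eventually_compose_filterlim[OF _ exceed_scale_at_top[OF \<alpha>]]) simp
  have ratio: "((\<lambda>u. T_tail (b * exceed_scale \<alpha> u) / T_tail (exceed_scale \<alpha> u)) \<longlongrightarrow> 1) at_top" if "b > 0" for b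
    using slow that unfolding slowly_varying_def
    by (intro filterlim_compose[where g="\<lambda>x. T_tail (b * x) / T_tail x", OF _ exceed_scale_at_top[OF \<alpha>]]) simp
  have "(R \<longlongrightarrow> 1) at_top"
  proof (rule order_tendstoI)
    fix a :: real assume a: "a < 1"
    \<comment> \<open>Gives \<open>1 - 2 * \<epsilon> = (1 + a) / 2\<close>, strictly between a and
      1.\<close>
    define \<epsilon> where "\<epsilon> = (1 - a) / 4"
    have \<epsilon>: "\<epsilon> > 0" "1 * (1 - 2 * \<epsilon>) > a" using a by (auto simp: \<epsilon>_def field_simps)
    obtain A where A: "A > 0" "\<forall>\<^sub>F u in at_top. prob (sup_exceed u) \<ge> T_tail (A * exceed_scale \<alpha> u) * (1 - 2 * \<epsilon>)"
      using prob_sup_exceed_lower[OF \<epsilon>(1)] by blast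
    have "((\<lambda>u. T_tail (A * exceed_scale \<alpha> u) / T_tail (exceed_scale \<alpha> u) * (1 - 2 * \<epsilon>)) \<longlongrightarrow> 1 * (1 - 2 * \<epsilon>)) at_top"
      by (intro tendsto_mult ratio A tendsto_const)
    then have "\<forall>\<^sub>F u in at_top. a < T_tail (A * exceed_scale \<alpha> u) / T_tail (exceed_scale \<alpha> u) * (1 - 2 * \<epsilon>)"
      using \<epsilon>(2) by (rule order_tendstoD(1))
    with A(2) tail_pos show "\<forall>\<^sub>F u in at_top. a < R u"
    proof eventually_elim
      case (elim u)
      have "T_tail (A * exceed_scale \<alpha> u) * (1 - 2 * \<epsilon>) / T_tail (exceed_scale \<alpha> u) \<le> R u"
        unfolding R_def using elim by (intro divide_right_mono) auto
      with elim show ?case by simp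
    qed
  next
    fix a :: real assume a: "a > 1"
    obtain K c where K: "K \<ge> 0"
      "\<And>\<epsilon>. \<epsilon> > 0 \<Longrightarrow> \<forall>\<^sub>F u in at_top. prob (sup_exceed u) \<le> T_tail (\<epsilon> * exceed_scale \<alpha> u) * (1 + K * \<epsilon>) + c / exceed_scale \<alpha> u"
      using prob_sup_exceed_upper[OF slow] by blast
    \<comment> \<open>Ensures \<open>K * \<epsilon> <= (a - 1) / 2\<close>; adding 1 to K avoids
      division by 0.\<close>
    define \<epsilon> where "\<epsilon> = (a - 1) / (2 * (K + 1))"
    have \<epsilon>: "\<epsilon> > 0" using a K by (simp add: \<epsilon>_def)
    have "K * \<epsilon> \<le> (K + 1) * \<epsilon>" using \<epsilon> by simp
    moreover have "2 * (K + 1) > 0" using K(1) by simp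
    then have "\<epsilon> * (2 * (K + 1)) = a - 1"
      by (intro nonzero_eq_divide_eq[THEN iffD1, OF _ \<epsilon>_def]) (rule less_imp_neq[symmetric])
    ultimately have "K * \<epsilon> \<le> (a - 1) / 2" by (simp add: algebra_simps)
    then have lt: "1 * (1 + K * \<epsilon>) + c * 0 < a" using a by simp
    have "filterlim (\<lambda>u. exceed_scale \<alpha> u * T_tail (exceed_scale \<alpha> u)) at_top at_top"
      by (rule filterlim_compose[OF slowly_varying_mult_id_at_top[OF slow T_tail_antimono] exceed_scale_at_top[OF \<alpha>]])
    then have "((\<lambda>u. inverse (exceed_scale \<alpha> u * T_tail (exceed_scale \<alpha> u))) \<longlongrightarrow> 0) at_top"
      by (rule tendsto_inverse_0_at_top)
    then have "((\<lambda>u. T_tail (\<epsilon> * exceed_scale \<alpha> u) / T_tail (exceed_scale \<alpha> u) * (1 + K * \<epsilon>)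
        + c * inverse (exceed_scale \<alpha> u * T_tail (exceed_scale \<alpha> u))) \<longlongrightarrow> 1 * (1 + K * \<epsilon>) + c * 0) at_top"
      by (intro tendsto_add tendsto_mult ratio \<epsilon> tendsto_const)
    then have "\<forall>\<^sub>F u in at_top. T_tail (\<epsilon> * exceed_scale \<alpha> u) / T_tail (exceed_scale \<alpha> u) * (1 + K * \<epsilon>)
        + c * inverse (exceed_scale \<alpha> u * T_tail (exceed_scale \<alpha> u)) < a"
      using lt by (rule order_tendstoD(2))
    with K(2)[OF \<epsilon>] tail_pos show "\<forall>\<^sub>F u in at_top. R u < a"
    proof eventually_elim
      case (elim u)
      have "R u \<le> (T_tail (\<epsilon> * exceed_scale \<alpha> u) * (1 + K * \<epsilon>) + c / exceed_scale \<alpha> u) / T_tail (exceed_scale \<alpha> u)"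
        unfolding R_def using elim by (intro divide_right_mono) auto
      also have "\<dots> = T_tail (\<epsilon> * exceed_scale \<alpha> u) / T_tail (exceed_scale \<alpha> u) * (1 + K * \<epsilon>)
        + c * inverse (exceed_scale \<alpha> u * T_tail (exceed_scale \<alpha> u))"
        by (simp add: divide_inverse algebra_simps)
      finally show ?case using elim by simp
    qed
  qed
  then show "((\<lambda>u. prob (sup_exceed u) / T_tail (exceed_scale \<alpha> u)) \<longlongrightarrow> 1) at_top"
    by (simp add: R_def[abs_def])
qed

end

section \<open>From the hypotheses of the theorem to the locale assumptions\<close>

lemma covariance_near_0:
  fixes r :: "real \<Rightarrow> real"
  assumes "C > 0" "\<alpha> > 0"
    and "(\<lambda>t. r t - (1 - C * \<bar>t\<bar> powr \<alpha>)) \<in> o[at_right 0](\<lambda>t. \<bar>t\<bar> powr \<alpha>)"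
  obtains \<delta> where "\<delta> > 0"
    "\<And>t. 0 < t \<Longrightarrow> t \<le> \<delta> \<Longrightarrow> C / 2 * t powr \<alpha> \<le> 1 - r t \<and> 1 - r t \<le> 2 * C * t powr \<alpha>"
proof -
  \<comment> \<open>An error of at most half the leading term \<open>w = C * t powr \<alpha>\<close>
    puts 1 - r between w / 2 and 3 w / 2.\<close>
  have "\<forall>\<^sub>F t in at_right 0. norm (r t - (1 - C * \<bar>t\<bar> powr \<alpha>)) \<le> C / 2 * norm (\<bar>t\<bar> powr \<alpha>)"
    using assms by (intro landau_o.smallD) auto
  then obtain b where b: "b > 0" "\<And>t. 0 < t \<Longrightarrow> t < b \<Longrightarrow> \<bar>r t - (1 - C * \<bar>t\<bar> powr \<alpha>)\<bar> \<le> C / 2 * \<bar>t\<bar> powr \<alpha>"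
    unfolding eventually_at_right[OF zero_less_one] by auto
  show thesis
  proof (rule that[of "b / 2"])
    fix t assume t: "0 < t" "t \<le> b / 2"
    define w where "w = C * t powr \<alpha>"
    have "\<bar>r t - (1 - w)\<bar> \<le> w / 2" using b(2)[of t] b(1) t by (simp add: w_def)
    moreover have "0 \<le> w" using assms by (simp add: w_def)
    ultimately have "w / 2 \<le> 1 - r t \<and> 1 - r t \<le> 2 * w" by arith
    then show "C / 2 * t powr \<alpha> \<le> 1 - r t \<and> 1 - r t \<le> 2 * C * t powr \<alpha>"
      by (simp add: w_def)
  qed (use b in simp)
qed

theorem theorem3p3:
  fixes M :: "'a measure" and X :: "real \<Rightarrow> 'a \<Rightarrow> real" and T :: "'a \<Rightarrow> real"
    and r :: "real \<Rightarrow> real" and \<alpha> C :: real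
  assumes "prob_space M"
    and gauss: "centered_gaussian_process M {0..} X"
    and cov: "\<And>s t. s \<ge> 0 \<Longrightarrow> t \<ge> 0 \<Longrightarrow>
                 prob_space.expectation M (\<lambda>\<omega>. X s \<omega> * X (s + t) \<omega>) = r t"
    and cont: "AE \<omega> in M. continuous_on {0..} (\<lambda>t. X t \<omega>)"
    and alpha: "0 < \<alpha>" "\<alpha> \<le> 2" and Cpos: "C > 0"
    and A1: "(\<lambda>t. r t - (1 - C * \<bar>t\<bar> powr \<alpha>)) \<in> o[at_right 0](\<lambda>t. \<bar>t\<bar> powr \<alpha>)"
    and A2: "\<And>t. t > 0 \<Longrightarrow> r t < 1"
    and A3: "((\<lambda>t. r t * ln t) \<longlongrightarrow> 0) at_top"
    and T_nonneg: "AE \<omega> in M. T \<omega> \<ge> 0"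
    and T_meas: "T \<in> borel_measurable M"
    and indep: "prob_space.indep_set M (sets (vimage_algebra (space M) T borel))
                  (sets (vimage_algebra (space M) (\<lambda>\<omega>. restrict (\<lambda>t. X t \<omega>) {0::real..})
                                         (Pi\<^sub>M {0::real..} (\<lambda>_. borel))))"
    and L: "slowly_varying (\<lambda>t. measure M {\<omega> \<in> space M. T \<omega> > t})"
  shows "(\<lambda>u. measure (completion M) {\<omega> \<in> space M. \<exists>s\<in>{0..T \<omega>}. X s \<omega> > u})
           \<sim>[at_top]
         (\<lambda>u. measure M {\<omega> \<in> space M. T \<omega> > u powr ((\<alpha> - 2) / \<alpha>) * exp (u\<^sup>2 / 2)})"
proof -
  interpret prob_space M by fact
  obtain \<delta> where \<delta>: "\<delta> > 0"
    "\<And>t. 0 < t \<Longrightarrow> t \<le> \<delta> \<Longrightarrow> C / 2 * t powr \<alpha> \<le> 1 - r t \<and> 1 - r t \<le> 2 * C * t powr \<alpha>"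
    by (rule covariance_near_0[OF Cpos alpha(1) A1]) blast
  have pw: "((\<lambda>t. c * t powr \<alpha>) \<longlongrightarrow> 0) (at_right 0)" for c
    using alpha(1) by real_asymp
  \<comment> \<open>The same two-sided bound supplies the right limit of r at 0 from which the
    locale derives \<open>r 0 = 1\<close>.\<close>
  have "((\<lambda>t. 1 - r t) \<longlongrightarrow> 0) (at_right 0)"
  proof (rule tendsto_sandwich[OF _ _ pw[of "C / 2"] pw[of "2 * C"]])
    have "\<forall>\<^sub>F t in at_right 0. 0 < t \<and> t \<le> \<delta>"
      using \<delta>(1) unfolding eventually_at_right[OF zero_less_one] by (intro exI[of _ \<delta>]) auto
    then show "\<forall>\<^sub>F t in at_right 0. C / 2 * t powr \<alpha> \<le> 1 - r t" "\<forall>\<^sub>F t in at_right 0. 1 - r t \<le> 2 * C * t powr \<alpha>"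
      by (auto elim!: eventually_mono dest: \<delta>(2))
  qed
  then have "((\<lambda>t. 1 - (1 - r t)) \<longlongrightarrow> 1 - 0) (at_right 0)"
    by (intro tendsto_diff tendsto_const)
  then have r1: "(r \<longlongrightarrow> 1) (at_right 0)" by simp
  interpret random_interval M X r \<alpha> C \<delta> T
    by unfold_locales (use assms r1 \<delta> in \<open>simp_all\<close>)
  have "slowly_varying T_tail" using L unfolding T_tail_def[abs_def] .
  from prob_sup_exceed_asymp[OF this] show ?thesis
    unfolding measure_completion_sup_exceed by (simp only: T_tail_def exceed_scale_def)
qed

end
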